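(* Let $Q_{10}=x^4+y^3+xz^2\in\mathbb{C}[x,y,z]$, with $|x|=\tfrac12$, $|y|=\tfrac23$, $|z|=\tfrac34$. Then $Q_{10}$ is orbifold equivalent to each of the following two potentials in $\mathbb{C}[u,v,w]$ describing the singularity $K_{14}$: (1) $K_{14}=u^4w+v^3+w^2$, with $|u|=\tfrac14$, $|v|=\tfrac23$, $|w|=1$; (2) $K_{14}=u^3+v^8+w^2$, with $|u|=\tfrac23$, $|v|=\tfrac14$, $|w|=1$. That is, for each of the two choices of $K_{14}$ there exists a finite-rank matrix factorization of $Q_{10}-K_{14}$ over $\mathbb{C}[x,y,z,u,v,w]$ whose left and right quantum dimensions are both non-zero.
   Context: Potential: a polynomial $W\in\mathbb{C}[x_1,\dots,x_n]$, with degrees $|x_i|\in\mathbb{Q}_{\ge 0}$ assigned to the variables, such that $\dim_{\mathbb{C}}\mathbb{C}[x_1,\dots,x_n]/\langle\partial_1W,\dots,\partial_nW\rangle<\infty$ and $W(\lambda^{|x_1|}x_1,\dots,\lambda^{|x_n|}x_n)=\lambda^2W(x_1,\dots,x_n)$ for all $\lambda\in\mathbb{C}^\times$. Matrix factorization: a matrix factorization of a polynomial $U$ in a polynomial ring $R$ over $\mathbb{C}$ is a pair $(M,d^M)$, where $M=M_0\oplus M_1$ is a $\mathbb{Z}_2$-graded free $R$-module and $d^M:M\to M$ is an $R$-linear endomorphism of degree 1 (odd, i.e. exchanging $M_0$ and $M_1$) with $d^M\circ d^M=U\cdot\mathrm{id}_M$. It has finite rank if $M$ has finite rank. Quantum dimensions: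 let $V(x_1,\dots,x_m)$ and $W(y_1,\dots,y_n)$ be potentials and $M$ a finite-rank matrix factorization of the difference of $V$ and $W$ over $\mathbb{C}[x_1,\dots,x_m,y_1,\dots,y_n]$. Choose homogeneous bases and regard $d^M$ as a matrix; partial derivatives of $d^M$ are taken entrywise, and $\mathrm{str}$ denotes the supertrace (trace on $M_0$ minus trace on $M_1$). Then $$\mathrm{qdim}_l(M)=(-1)^{\binom{m+1}{2}}\,\mathrm{Res}\left[\frac{\mathrm{str}(\partial_{x_1}d^M\cdots\partial_{x_m}d^M\,\partial_{y_1}d^M\cdots\partial_{y_n}d^M)\,dy_1\cdots dy_n}{\partial_{y_1}W,\dots,\partial_{y_n}W}\right],$$ $$\mathrm{qdim}_r(M)=(-1)^{\binom{n+1}{2}}\,\mathrm{Res}\left[\frac{\mathrm{str}(\partial_{x_1}d^M\cdots\partial_{x_m}d^M\,\partial_{y_1}d^M\cdots\partial_{y_n}d^M)\,dx_1\cdots dx_m}{\partial_{x_1}V,\dots,\partial_{x_m}V}\right].$$ Here $\mathrm{Res}$ is the Grothendieck residue, taken linearly over the polynomial ring in the variables that are not integrated: if $f_1,\dots,f_n\in\mathbb{C}[y_1,\dots,y_n]$ have finite-dimensional quotient and $y_i^{N}=\sum_jC_{ij}f_j$ for all $i$ (such $N$ and $C_{ij}$ exist when the $f_j$ are the partial derivatives of a potential), then $\mathrm{Res}\left[\frac{g\,dy_1\cdots dy_n}{f_1,\dots,f_n}\right]$ is the coefficient of $y_1^{N-1}\cdots y_n^{N-1}$ in $\det(C)\,g$.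 Orbifold equivalence: potentials $V$ and $W$ are orbifold equivalent, $V\sim_{\mathrm{orb}}W$, if there is a finite-rank matrix factorization of $V-W$ whose left and right quantum dimensions are both non-zero. *)

theory Defs
  imports
    "HOL-Analysis.Complex_Transcendental"
    "HOL-Library.Poly_Mapping"
    "Jordan_Normal_Form.Matrix"
    "Jordan_Normal_Form.Determinant"
begin

section \<open>Polynomials in several variables\<close>

text \<open>
  Complex polynomials in variables from the type \<open>'v\<close>: finitely supported maps from exponent
  vectors to coefficients, with the commutative ring structure (convolution product) of the library.
  The polynomial ring in a given set \<open>S\<close> of variables is the subset \<open>polys_in S\<close>.
\<close>

type_synonym 'v cpoly = "('v \<Rightarrow>\<^sub>0 nat) \<Rightarrow>\<^sub>0 complex"

definition Var :: "'v \<Rightarrow> 'v cpoly" where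
  "Var x = Poly_Mapping.single (Poly_Mapping.single x 1) 1"

definition Const :: "complex \<Rightarrow> 'v cpoly" where
  "Const c = Poly_Mapping.single 0 c"

definition polys_in :: "'v set \<Rightarrow> 'v cpoly set" where
  "polys_in S = {p. \<forall>t\<in>Poly_Mapping.keys p. Poly_Mapping.keys t \<subseteq> S}"

definition eval_poly :: "('v \<Rightarrow> complex) \<Rightarrow> 'v cpoly \<Rightarrow> complex" where
  "eval_poly a p = (\<Sum>t\<in>Poly_Mapping.keys p. Poly_Mapping.lookup p t *
      (\<Prod>x\<in>Poly_Mapping.keys t. a x ^ Poly_Mapping.lookup t x))"

text \<open>
  In \<open>partial\<close>, terms not containing \<open>x\<close> get coefficient \<open>0\<close>, so the truncated subtraction of
  exponents is harmless.
\<close>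

definition partial :: "'v \<Rightarrow> 'v cpoly \<Rightarrow> 'v cpoly" where
  "partial x p = (\<Sum>t\<in>Poly_Mapping.keys p.
      Poly_Mapping.single (t - Poly_Mapping.single x 1)
        (of_nat (Poly_Mapping.lookup t x) * Poly_Mapping.lookup p t))"

text \<open>
  \<open>coeff_wrt S k p\<close> is the coefficient of \<open>\<Prod>x\<in>S. x ^ k\<close> (\<open>S\<close> finite) when \<open>p\<close> is regarded as a
  polynomial in the variables \<open>S\<close> whose coefficients are polynomials in the other variables.
\<close>

definition coeff_wrt :: "'v set \<Rightarrow> nat \<Rightarrow> 'v cpoly \<Rightarrow> 'v cpoly" where
  "coeff_wrt S k p =
     (\<Sum>t\<in>{t \<in> Poly_Mapping.keys p. \<forall>x\<in>S. Poly_Mapping.lookup t x = k}.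
        Poly_Mapping.single (t - (\<Sum>x\<in>S. Poly_Mapping.single x k)) (Poly_Mapping.lookup p t))"


section \<open>Potentials\<close>

definition jacobian_ideal :: "'v list \<Rightarrow> 'v cpoly \<Rightarrow> 'v cpoly set" where
  "jacobian_ideal xs W =
     {\<Sum>x\<in>set xs. c x * partial x W | c. \<forall>x\<in>set xs. c x \<in> polys_in (set xs)}"

text \<open>
  Finite dimension of the complex vector space \<open>polys_in (set xs)\<close> modulo the Jacobian ideal:
  the classes of finitely many polynomials span the quotient.
\<close>

definition finite_dim_jacobian :: "'v list \<Rightarrow> 'v cpoly \<Rightarrow> bool" where
  "finite_dim_jacobian xs W \<longleftrightarrow>
     (\<exists>B. finite B \<and> B \<subseteq> polys_in (set xs) \<and>
        (\<forall>p\<in>polys_in (set xs). \<exists>s\<in>module.span (\<lambda>c q. Const c * q) B.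
            p - s \<in> jacobian_ideal xs W))"

definition potential :: "'v list \<Rightarrow> ('v \<Rightarrow> rat) \<Rightarrow> 'v cpoly \<Rightarrow> bool" where
  "potential xs deg W \<longleftrightarrow>
     distinct xs \<and> W \<in> polys_in (set xs) \<and> (\<forall>x\<in>set xs. 0 \<le> deg x) \<and>
     finite_dim_jacobian xs W \<and>
     (\<forall>l a. l \<noteq> 0 \<longrightarrow>
        eval_poly (\<lambda>x. l powr of_rat (deg x) * a x) W = l ^ 2 * eval_poly a W)"


section \<open>Matrix factorizations\<close>

text \<open>
  A finite-rank \<open>\<int>\<^sub>2\<close>-graded free module over \<open>polys_in S\<close>, with a chosen homogeneous basis, is given
  by the ranks \<open>r0\<close> and \<open>r1\<close> of its even and odd parts; the even basis elements come first.
  Its endomorphisms are square matrices of size \<open>r0 + r1\<close> with entries in \<open>polys_in S\<close>.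
\<close>

definition odd_mat :: "nat \<Rightarrow> nat \<Rightarrow> 'v cpoly mat \<Rightarrow> bool" where
  "odd_mat r0 r1 D \<longleftrightarrow>
     (\<forall>i<r0 + r1. \<forall>j<r0 + r1. (i < r0 \<longleftrightarrow> j < r0) \<longrightarrow> D $$ (i, j) = 0)"

definition matrix_factorization ::
    "'v set \<Rightarrow> 'v cpoly \<Rightarrow> nat \<Rightarrow> nat \<Rightarrow> 'v cpoly mat \<Rightarrow> bool" where
  "matrix_factorization S F r0 r1 D \<longleftrightarrow>
     D \<in> carrier_mat (r0 + r1) (r0 + r1) \<and> elements_mat D \<subseteq> polys_in S \<and>
     odd_mat r0 r1 D \<and> D * D = F \<cdot>\<^sub>m 1\<^sub>m (r0 + r1)"

definition supertrace :: "nat \<Rightarrow> nat \<Rightarrow> 'v cpoly mat \<Rightarrow> 'v cpoly" where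
  "supertrace r0 r1 A = (\<Sum>i<r0. A $$ (i, i)) - (\<Sum>i=r0..<r0 + r1. A $$ (i, i))"

definition partials_prod :: "'v list \<Rightarrow> 'v cpoly mat \<Rightarrow> 'v cpoly mat" where
  "partials_prod zs D = foldr (\<lambda>z A. map_mat (partial z) D * A) zs (1\<^sub>m (dim_row D))"


section \<open>Grothendieck residues and quantum dimensions\<close>

text \<open>
  \<open>has_residue ys fs g r\<close>: the residue of \<open>g\<close> with respect to the variables \<open>ys\<close> and the
  polynomials \<open>fs\<close> in these variables is computed as \<open>r\<close> from some \<open>N\<close> and \<open>C\<close> with
  \<open>y\<^sub>i ^ N = (\<Sum>j. C\<^sub>i\<^sub>j * f\<^sub>j)\<close>. The result does not depend on the choice of \<open>N\<close> and \<open>C\<close>, and it is a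
  polynomial in the variables of \<open>g\<close> that are not in \<open>ys\<close>. The case \<open>N = 0\<close> is excluded since the
  exponent \<open>N - 1\<close> would be truncated.
\<close>

definition has_residue ::
    "'v list \<Rightarrow> 'v cpoly list \<Rightarrow> 'v cpoly \<Rightarrow> 'v cpoly \<Rightarrow> bool" where
  "has_residue ys fs g r \<longleftrightarrow>
     (\<exists>N C. 0 < N \<and> C \<in> carrier_mat (length ys) (length ys) \<and>
        elements_mat C \<subseteq> polys_in (set ys) \<and>
        (\<forall>i<length ys. Var (ys ! i) ^ N = (\<Sum>j<length ys. C $$ (i, j) * fs ! j)) \<and>
        r = coeff_wrt (set ys) (N - 1) (Determinant.det C * g))"

definition residue :: "'v list \<Rightarrow> 'v cpoly list \<Rightarrow> 'v cpoly \<Rightarrow> 'v cpoly" where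
  "residue ys fs g = (THE r. has_residue ys fs g r)"

text \<open>
  Quantum dimensions of a matrix factorization \<open>D\<close> of \<open>V - W\<close>, with \<open>V\<close> a potential in the
  variables \<open>xs\<close> and \<open>W\<close> a potential in the variables \<open>ys\<close>.
\<close>

definition qdim_l ::
    "'v list \<Rightarrow> 'v list \<Rightarrow> 'v cpoly \<Rightarrow> nat \<Rightarrow> nat \<Rightarrow> 'v cpoly mat \<Rightarrow> 'v cpoly" where
  "qdim_l xs ys W r0 r1 D =
     (- 1) ^ ((length xs + 1) choose 2) *
     residue ys (map (\<lambda>y. partial y W) ys) (supertrace r0 r1 (partials_prod (xs @ ys) D))"

definition qdim_r ::
    "'v list \<Rightarrow> 'v list \<Rightarrow> 'v cpoly \<Rightarrow> nat \<Rightarrow> nat \<Rightarrow> 'v cpoly mat \<Rightarrow> 'v cpoly" where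
  "qdim_r xs ys V r0 r1 D =
     (- 1) ^ ((length ys + 1) choose 2) *
     residue xs (map (\<lambda>x. partial x V) xs) (supertrace r0 r1 (partials_prod (xs @ ys) D))"

definition orbifold_equivalent ::
    "'v list \<Rightarrow> ('v \<Rightarrow> rat) \<Rightarrow> 'v cpoly \<Rightarrow> 'v list \<Rightarrow> ('v \<Rightarrow> rat) \<Rightarrow> 'v cpoly \<Rightarrow> bool" where
  "orbifold_equivalent xs degx V ys degy W \<longleftrightarrow>
     potential xs degx V \<and> potential ys degy W \<and> set xs \<inter> set ys = {} \<and>
     (\<exists>r0 r1 D. matrix_factorization (set xs \<union> set ys) (V - W) r0 r1 D \<and>
        qdim_l xs ys W r0 r1 D \<noteq> 0 \<and> qdim_r xs ys V r0 r1 D \<noteq> 0)"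


section \<open>The singularities\<close>

datatype indet = Ix | Iy | Iz | Iu | Iv | Iw

definition Q10 :: "indet cpoly" where
  "Q10 = Var Ix ^ 4 + Var Iy ^ 3 + Var Ix * Var Iz ^ 2"

definition K14_1 :: "indet cpoly" where
  "K14_1 = Var Iu ^ 4 * Var Iw + Var Iv ^ 3 + Var Iw ^ 2"

definition K14_2 :: "indet cpoly" where
  "K14_2 = Var Iu ^ 3 + Var Iv ^ 8 + Var Iw ^ 2"

end

theory Submission
  imports Defs
begin

text \<open>
  Write \<open>Q10 = y ^ 3 + (x ^ 4 + x * z ^ 2)\<close>. Completing the square in \<open>w\<close> brings both versions of \<open>K14\<close> to
  the form \<open>c ^ 3 + (w + t * a ^ 4) ^ 2 + s ^ 8 * a ^ 8\<close>. So the cubes can be matched by the identity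
  defect \<open>y ^ 3 - c ^ 3 = (y - c) * (y ^ 2 + y * c + c ^ 2)\<close>, and what remains is the known orbifold
  equivalence between singularities of types \<open>D\<^sub>5\<close> and \<open>A\<^sub>7\<close>: the hypersurface \<open>x = s ^ 2 * a ^ 2\<close> turns
  the rest of the difference into a difference of two squares. Altogether \<open>Q10 - K14\<close> is a sum of three
  products, which gives a Koszul matrix factorization \<open>Q10_K14_mf\<close> of rank 4 + 4 (lemma
  \<open>matrix_factorization_mf\<close>).

  The partial derivatives of a Koszul differential are vectors in a Clifford algebra of rank 6, and the
  supertrace of the product of six such vectors is, up to sign, a 6 by 6 determinant. Hence the numerator
  of both quantum dimensions is the Jacobian determinant of the six factors, the polynomial \<open>Q10_K14_jacobian\<close>
  (lemmas \<open>supertrace_koszul3\<close> and \<open>supertrace_mf\<close>). Its residues are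
  found by multiplying it with the determinant of an explicit matrix that expresses powers of the
  variables by partial derivatives, and reading off one coefficient: it is \<open>\<plusminus> 2 * s\<close> on one side
  and a non-zero multiple of \<open>s ^ 7\<close> on the other (lemmas \<open>coefficient_right\<close>, \<open>coefficient_left_1\<close> and
  \<open>coefficient_left_2\<close>).

  Since the residue is defined by a definite description, this computation only counts once the residue is
  known not to depend on the choice of the matrix (lemma \<open>has_residue_unique\<close>). The reason is that two
  choices have determinants that differ by an element of the ideal generated by the powers of the variables,
  by Cramer's rule and the regularity of the sequence of these powers.
\<close>

section \<open>Polynomials as sums of monomials\<close>

lemma sum_monomials: "(\<Sum>t\<in>Poly_Mapping.keys p. Poly_Mapping.single t (Poly_Mapping.lookup p t)) = p"
  by (rule poly_mapping_eqI)
    (auto simp: lookup_sum lookup_single when_def in_keys_iff)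

text \<open>
  The zero polynomial is the monomial with coefficient 0, so these two cases suffice.
\<close>

lemma cpoly_induct [case_names monomial add]:
  assumes "\<And>t c. P (Poly_Mapping.single t c)" and "\<And>p q. P p \<Longrightarrow> P q \<Longrightarrow> P (p + q)"
  shows "P (p :: 'v cpoly)"
proof -
  have "P (\<Sum>t\<in>T. Poly_Mapping.single t (Poly_Mapping.lookup p t))" if "finite T" for T
    using that
  proof (induction T rule: finite_induct)
    case empty
    show ?case using assms(1)[of 0 0] by simp
  qed (simp add: assms)
  from this[OF finite_keys[of p]] show ?thesis by (simp add: sum_monomials)
qed

lemma lookup_monomial_mult:
  fixes p :: "'v cpoly"
  shows "Poly_Mapping.lookup (Poly_Mapping.single u c * p) (u + v) = c * Poly_Mapping.lookup p v"
  by (induction p rule: cpoly_induct)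
    (auto simp: mult_single lookup_single lookup_add distrib_left when_def)

lemma Const_0 [simp]: "Const 0 = 0"
  and Const_1 [simp]: "Const 1 = 1"
  and Const_add: "Const (a + b) = Const a + Const b"
  and Const_mult: "Const (a * b) = Const a * Const b"
  by (simp_all add: Const_def single_add mult_single)

lemma Const_power: "Const (a ^ n) = Const a ^ n"
  by (induction n) (simp_all add: Const_mult)

lemma Const_numeral [simp]: "Const (numeral n) = numeral n"
  by (simp add: Const_def)

lemma Var_power: "Var x ^ n = Poly_Mapping.single (Poly_Mapping.single x n) 1"
  by (induction n) (simp_all add: Var_def mult_single single_add[symmetric])

lemma prod_Var_power:
  "(\<Prod>x\<in>S. Var x ^ n) = Poly_Mapping.single (\<Sum>x\<in>S. Poly_Mapping.single x n) 1"
  by (induction S rule: infinite_finite_induct) (simp_all add: Var_power mult_single)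

lemma Const_times_monomial: "Const a * Poly_Mapping.single t c = Poly_Mapping.single t (a * c)"
  by (simp add: Const_def mult_single)

section \<open>Rings of polynomials in some of the variables\<close>

lemma polys_in_Var [intro]: "x \<in> S \<Longrightarrow> Var x \<in> polys_in S"
  and polys_in_Const [intro]: "Const c \<in> polys_in S"
  by (auto simp: polys_in_def Var_def Const_def split: if_splits)

lemma polys_in_add [intro]: "p \<in> polys_in S \<Longrightarrow> q \<in> polys_in S \<Longrightarrow> p + q \<in> polys_in S"
  using keys_add[of p q] unfolding polys_in_def by blast

lemma polys_in_uminus [intro]: "p \<in> polys_in S \<Longrightarrow> - p \<in> polys_in S"
  by (auto simp: polys_in_def in_keys_iff)

lemma polys_in_diff [intro]: "p \<in> polys_in S \<Longrightarrow> q \<in> polys_in S \<Longrightarrow> p - q \<in> polys_in S"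
  using polys_in_add[of p S "- q"] polys_in_uminus[of q S] by simp

lemma polys_in_mult [intro]: "p \<in> polys_in S \<Longrightarrow> q \<in> polys_in S \<Longrightarrow> p * q \<in> polys_in S"
proof -
  assume p: "p \<in> polys_in S" and q: "q \<in> polys_in S"
  show "p * q \<in> polys_in S"
    unfolding polys_in_def
  proof safe
    fix t x assume "t \<in> Poly_Mapping.keys (p * q)" and x: "x \<in> Poly_Mapping.keys t"
    then obtain a b where "t = a + b" "a \<in> Poly_Mapping.keys p" "b \<in> Poly_Mapping.keys q"
      using keys_mult[of p q] by blast
    then show "x \<in> S"
      using p q x keys_add[of a b] unfolding polys_in_def by blast
  qed
qed

lemma polys_in_0 [intro]: "0 \<in> polys_in S"
  and polys_in_1 [intro]: "1 \<in> polys_in S"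
  and polys_in_numeral [intro]: "numeral n \<in> polys_in S"
  using polys_in_Const[of 0 S] polys_in_Const[of 1 S] polys_in_Const[of "numeral n" S] by simp_all

lemma polys_in_power [intro]: "p \<in> polys_in S \<Longrightarrow> p ^ n \<in> polys_in S"
  by (induction n) auto

section \<open>Evaluation and partial derivatives\<close>

lemma eval_poly_add: "eval_poly a (p + q) = eval_poly a p + eval_poly a q"
  unfolding eval_poly_def by (rule setsum_keys_plus_distrib) (simp_all add: algebra_simps)

lemma eval_poly_monomial:
  "eval_poly a (Poly_Mapping.single t c) =
    c * (\<Prod>x\<in>Poly_Mapping.keys t. a x ^ Poly_Mapping.lookup t x)"
  by (simp add: eval_poly_def)

lemma eval_poly_mult: "eval_poly a (p * q) = eval_poly a p * eval_poly a q"
proof (induction p rule: cpoly_induct)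
  case (monomial s c)
  show ?case
  proof (induction q rule: cpoly_induct)
    case (monomial t d)
    let ?m = "\<lambda>t. \<Prod>x\<in>Poly_Mapping.keys t. a x ^ Poly_Mapping.lookup t x"
    have m: "?m u = (\<Prod>x\<in>Poly_Mapping.keys s \<union> Poly_Mapping.keys t. a x ^ Poly_Mapping.lookup u x)"
      if "Poly_Mapping.keys u \<subseteq> Poly_Mapping.keys s \<union> Poly_Mapping.keys t" for u
      using that by (intro prod.mono_neutral_left) (auto simp: in_keys_iff)
    have "?m (s + t) = ?m s * ?m t"
      unfolding m[OF keys_add] m[OF Un_upper1] m[OF Un_upper2]
      by (simp add: lookup_add power_add prod.distrib)
    then show ?case by (simp add: mult_single eval_poly_monomial)
  qed (simp add: eval_poly_add algebra_simps)
qed (simp add: eval_poly_add algebra_simps)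

lemma eval_poly_Var: "eval_poly a (Var x) = a x"
  and eval_poly_Const: "eval_poly a (Const c) = c"
  by (simp_all add: Var_def Const_def eval_poly_monomial)

lemma eval_poly_power: "eval_poly a (p ^ n) = eval_poly a p ^ n"
  using eval_poly_Const[of a 1] by (induction n) (simp_all add: eval_poly_mult)

lemma partial_add: "partial x (p + q) = partial x p + partial x q"
  unfolding partial_def
  by (rule setsum_keys_plus_distrib) (simp_all add: distrib_left single_add)

lemma partial_monomial:
  "partial x (Poly_Mapping.single t c) =
    Poly_Mapping.single (t - Poly_Mapping.single x 1) (of_nat (Poly_Mapping.lookup t x) * c)"
  by (simp add: partial_def)

text \<open>
  Both sides are additive in each factor, which leaves the case of two monomials. There the only
  subtlety is the truncated subtraction of exponents: it is wrong exactly when the variable does not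
  occur, and then the coefficient of the term is 0.
\<close>

lemma partial_mult: "partial x (p * q) = partial x p * q + p * partial x q"
proof (induction p rule: cpoly_induct)
  case (monomial s c)
  show ?case
  proof (induction q rule: cpoly_induct)
    case (monomial t d)
    let ?e = "Poly_Mapping.single x (Suc 0) :: 'a \<Rightarrow>\<^sub>0 nat"
    have shift: "(u + v) - ?e = (u - ?e) + v" if "Poly_Mapping.lookup u x \<noteq> 0"
      for u v :: "'a \<Rightarrow>\<^sub>0 nat"
      using that by (intro poly_mapping_eqI) (auto simp: lookup_add lookup_minus lookup_single when_def)
    have "Poly_Mapping.single ((s - ?e) + t) (of_nat (Poly_Mapping.lookup s x) * c * d) =
        Poly_Mapping.single (s + t - ?e) (of_nat (Poly_Mapping.lookup s x) * c * d)"
      by (cases "Poly_Mapping.lookup s x = 0") (simp_all add: shift)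
    moreover have "Poly_Mapping.single (s + (t - ?e)) (c * (of_nat (Poly_Mapping.lookup t x) * d)) =
        Poly_Mapping.single (s + t - ?e) (c * (of_nat (Poly_Mapping.lookup t x) * d))"
      using shift[of t s]
      by (cases "Poly_Mapping.lookup t x = 0") (simp_all add: add.commute)
    ultimately show ?case
      by (simp add: mult_single partial_monomial lookup_add single_add[symmetric] algebra_simps)
  qed (simp add: partial_add algebra_simps)
qed (simp add: partial_add algebra_simps)

lemma partial_Const [simp]: "partial x (Const c) = 0"
  by (simp add: Const_def partial_monomial)

lemma partial_0 [simp]: "partial x 0 = 0"
  and partial_1 [simp]: "partial x 1 = 0"
  and partial_numeral [simp]: "partial x (numeral n) = 0"
  using partial_Const[of x 0] partial_Const[of x 1] partial_Const[of x "numeral n"]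
  by simp_all

lemma partial_Var: "partial x (Var y) = (if x = y then 1 else 0)"
  by (simp add: Var_def partial_monomial lookup_single)

lemma partial_Const_power [simp]: "partial x (Const c ^ n) = 0"
  by (simp flip: Const_power)

lemma partial_uminus: "partial x (- p) = - partial x p"
  using partial_add[of x p "- p"] by (simp add: eq_neg_iff_add_eq_0 add.commute)

lemma partial_diff: "partial x (p - q) = partial x p - partial x q"
  using partial_add[of x p "- q"] by (simp add: partial_uminus)

lemma partial_power: "partial x (p ^ n) = of_nat n * p ^ (n - 1) * partial x p"
proof (induction n)
  case (Suc n)
  then show ?case by (cases n) (simp_all add: partial_mult algebra_simps)
qed simp

section \<open>Ideals generated by powers of variables\<close>

lemma lookup_coeff_wrt:
  assumes S: "finite S"
  shows "Poly_Mapping.lookup (coeff_wrt S k p) t =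
    (if Poly_Mapping.keys t \<inter> S = {}
     then Poly_Mapping.lookup p (t + (\<Sum>x\<in>S. Poly_Mapping.single x k)) else 0)"
proof -
  define e where "e = (\<Sum>x\<in>S. Poly_Mapping.single x k)"
  have e: "Poly_Mapping.lookup e x = (if x \<in> S then k else 0)" for x
    using S by (simp add: e_def lookup_sum lookup_single when_def)
  have *: "(\<forall>x\<in>S. Poly_Mapping.lookup u x = k) \<and> u - e = t \<longleftrightarrow>
      u = t + e \<and> Poly_Mapping.keys t \<inter> S = {}" for u
    by (auto simp: poly_mapping_eq_iff fun_eq_iff lookup_add lookup_minus e in_keys_iff disjoint_iff)
  have "Poly_Mapping.lookup (coeff_wrt S k p) t =
    (\<Sum>u\<in>Poly_Mapping.keys p.
       if (\<forall>x\<in>S. Poly_Mapping.lookup u x = k) \<and> u - e = t then Poly_Mapping.lookup p u else 0)"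
    unfolding coeff_wrt_def e_def[symmetric]
    by (auto simp: lookup_sum lookup_single when_def sum.inter_filter intro!: sum.cong)
  also have "\<dots> = (if Poly_Mapping.keys t \<inter> S = {} then Poly_Mapping.lookup p (t + e) else 0)"
    unfolding * by (auto simp: in_keys_iff)
  finally show ?thesis unfolding e_def .
qed

text \<open>
  The ideal generated by the powers \<open>x ^ N\<close> with \<open>x \<in> S\<close>. Being a monomial ideal, it can be described
  by the monomials of its elements, and this makes membership easy to test.
\<close>

definition power_ideal :: "'v set \<Rightarrow> nat \<Rightarrow> 'v cpoly set" where
  "power_ideal S N = {p. \<forall>t\<in>Poly_Mapping.keys p. \<exists>x\<in>S. N \<le> Poly_Mapping.lookup t x}"

lemma power_ideal_0: "0 \<in> power_ideal S N"
  by (simp add: power_ideal_def)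

lemma power_ideal_add: "p \<in> power_ideal S N \<Longrightarrow> q \<in> power_ideal S N \<Longrightarrow> p + q \<in> power_ideal S N"
  using keys_add[of p q] unfolding power_ideal_def by blast

lemma power_ideal_sum: "(\<And>i. i \<in> I \<Longrightarrow> p i \<in> power_ideal S N) \<Longrightarrow> sum p I \<in> power_ideal S N"
  by (induction I rule: infinite_finite_induct) (auto intro: power_ideal_0 power_ideal_add)

lemma power_ideal_mult:
  assumes "p \<in> power_ideal S N"
  shows "q * p \<in> power_ideal S N"
  unfolding power_ideal_def
proof safe
  fix t assume "t \<in> Poly_Mapping.keys (q * p)"
  then obtain a b where "t = a + b" "b \<in> Poly_Mapping.keys p"
    using keys_mult[of q p] by blast
  then show "\<exists>x\<in>S. N \<le> Poly_Mapping.lookup t x"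
    using assms by (force simp: power_ideal_def lookup_add)
qed

lemma power_ideal_Var: "x \<in> S \<Longrightarrow> Var x ^ N \<in> power_ideal S N"
  by (auto simp: power_ideal_def Var_power intro!: bexI[of _ x])

lemma power_ideal_mono: "S \<subseteq> T \<Longrightarrow> power_ideal S N \<subseteq> power_ideal T N"
  by (fastforce simp: power_ideal_def)

text \<open>
  The powers of the variables form a regular sequence: \<open>x ^ N\<close> is not a zero divisor modulo powers of
  other variables.
\<close>

lemma power_ideal_cancel:
  assumes "Var x ^ N * p \<in> power_ideal S N" and "x \<notin> S"
  shows "p \<in> power_ideal S N"
  unfolding power_ideal_def
proof safe
  fix t assume "t \<in> Poly_Mapping.keys p"
  then have "Poly_Mapping.single x N + t \<in> Poly_Mapping.keys (Var x ^ N * p)"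
    by (simp add: in_keys_iff Var_power lookup_monomial_mult)
  then obtain y where "y \<in> S" "N \<le> Poly_Mapping.lookup (Poly_Mapping.single x N + t) y"
    using assms(1) unfolding power_ideal_def by blast
  moreover from this have "x \<noteq> y" using assms(2) by blast
  ultimately show "\<exists>x\<in>S. N \<le> Poly_Mapping.lookup t x"
    by (auto simp: lookup_add lookup_single)
qed

text \<open>
  Every monomial of an element of the ideal has an exponent larger than \<open>k\<close> in some variable from \<open>S\<close>,
  so it does not contribute to the coefficient of \<open>\<Prod>x\<in>S. x ^ k\<close>.
\<close>

lemma coeff_wrt_power_ideal:
  assumes "finite S" and "p - q \<in> power_ideal S (Suc k)"
  shows "coeff_wrt S k p = coeff_wrt S k q"
proof (rule poly_mapping_eqI)
  fix t
  let ?e = "\<Sum>x\<in>S. Poly_Mapping.single x k"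
  have "Poly_Mapping.lookup p (t + ?e) = Poly_Mapping.lookup q (t + ?e)"
    if "Poly_Mapping.keys t \<inter> S = {}"
  proof -
    have "Poly_Mapping.lookup (t + ?e) x = k" if "x \<in> S" for x
      using \<open>Poly_Mapping.keys t \<inter> S = {}\<close> that assms(1)
      by (auto simp: lookup_add lookup_sum lookup_single when_def in_keys_iff)
    then have "t + ?e \<notin> Poly_Mapping.keys (p - q)"
      using assms(2) by (fastforce simp: power_ideal_def)
    then show ?thesis by (simp add: in_keys_iff lookup_minus)
  qed
  then show "Poly_Mapping.lookup (coeff_wrt S k p) t = Poly_Mapping.lookup (coeff_wrt S k q) t"
    by (simp add: lookup_coeff_wrt assms(1))
qed

lemma coeff_wrt_shift:
  assumes "finite S"
  shows "coeff_wrt S (k + m) ((\<Prod>x\<in>S. Var x ^ m) * p) = coeff_wrt S k p"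
proof (rule poly_mapping_eqI)
  fix t
  have "t + (\<Sum>x\<in>S. Poly_Mapping.single x (k + m)) =
      (\<Sum>x\<in>S. Poly_Mapping.single x m) + (t + (\<Sum>x\<in>S. Poly_Mapping.single x k))"
    by (simp add: single_add sum.distrib ac_simps)
  then show "Poly_Mapping.lookup (coeff_wrt S (k + m) ((\<Prod>x\<in>S. Var x ^ m) * p)) t =
      Poly_Mapping.lookup (coeff_wrt S k p) t"
    by (simp add: lookup_coeff_wrt assms prod_Var_power lookup_monomial_mult)
qed

section \<open>Well-definedness of the residue\<close>

text \<open>
  Cramer's rule without division: multiply the linear system by the adjugate matrix.
\<close>

lemma det_mult_solution:
  fixes A :: "'a :: comm_ring_1 mat"
  assumes A: "A \<in> carrier_mat n n" and b: "\<And>i. i < n \<Longrightarrow> (\<Sum>j<n. A $$ (i, j) * f j) = b i"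
    and k: "k < n"
  shows "Determinant.det A * f k = (\<Sum>i<n. adj_mat A $$ (k, i) * b i)"
proof -
  note adj = adj_mat[OF A]
  have "(\<Sum>i<n. adj_mat A $$ (k, i) * A $$ (i, j)) = (adj_mat A * A) $$ (k, j)" if "j < n" for j
    using adj(1) A k that by (simp add: scalar_prod_def atLeast0LessThan)
  also have "\<dots> j = (if j = k then Determinant.det A else 0)" if "j < n" for j
    using k that by (auto simp: adj(3))
  finally have *: "(\<Sum>i<n. adj_mat A $$ (k, i) * A $$ (i, j)) = (if j = k then Determinant.det A else 0)"
    if "j < n" for j using that by simp
  have "(\<Sum>i<n. adj_mat A $$ (k, i) * b i) =
      (\<Sum>i<n. \<Sum>j<n. adj_mat A $$ (k, i) * A $$ (i, j) * f j)"
    by (simp add: b[symmetric] sum_distrib_left mult.assoc)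
  also have "\<dots> = (\<Sum>j<n. (\<Sum>i<n. adj_mat A $$ (k, i) * A $$ (i, j)) * f j)"
    by (subst sum.swap) (simp add: sum_distrib_right)
  also have "\<dots> = (\<Sum>j<n. if j = k then Determinant.det A * f k else 0)"
    by (rule sum.cong) (auto simp: *)
  also have "\<dots> = Determinant.det A * f k" using k by simp
  finally show ?thesis by simp
qed

text \<open>
  The determinant is additive in a single row, by Laplace expansion along it.
\<close>

lemma det_row_diff:
  fixes A B :: "'a :: comm_ring_1 mat"
  assumes A: "A \<in> carrier_mat n n" and B: "B \<in> carrier_mat n n" and k: "k < n"
    and AB: "\<And>i j. i < n \<Longrightarrow> j < n \<Longrightarrow> i \<noteq> k \<Longrightarrow> A $$ (i, j) = B $$ (i, j)"
  shows "Determinant.det (mat n n (\<lambda>(i, j). if i = k then A $$ (k, j) - B $$ (k, j) else A $$ (i, j))) =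
    Determinant.det A - Determinant.det B"
proof -
  define R where "R = mat n n (\<lambda>(i, j). if i = k then A $$ (k, j) - B $$ (k, j) else A $$ (i, j))"
  have R: "R \<in> carrier_mat n n" by (simp add: R_def)
  have cof: "cofactor M k j = cofactor A k j"
    if "M \<in> carrier_mat n n" "\<And>i j. i < n \<Longrightarrow> j < n \<Longrightarrow> i \<noteq> k \<Longrightarrow> M $$ (i, j) = A $$ (i, j)" "j < n"
    for M j
  proof -
    have "mat_delete M k j = mat_delete A k j"
      using that A k by (intro eq_matI) (auto simp: mat_delete_def)
    then show ?thesis by (simp add: cofactor_def)
  qed
  have "Determinant.det R = (\<Sum>j<n. (A $$ (k, j) - B $$ (k, j)) * cofactor A k j)"
    unfolding laplace_expansion_row[OF R k]
  proof (rule sum.cong)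
    fix j assume "j \<in> {..<n}"
    then show "R $$ (k, j) * cofactor R k j = (A $$ (k, j) - B $$ (k, j)) * cofactor A k j"
      using k by (subst cof[OF R]) (auto simp: R_def)
  qed simp
  also have "\<dots> = (\<Sum>j<n. A $$ (k, j) * cofactor A k j) - (\<Sum>j<n. B $$ (k, j) * cofactor B k j)"
    by (simp add: cof[OF B] AB left_diff_distrib sum_subtractf)
  also have "\<dots> = Determinant.det A - Determinant.det B"
    by (simp add: laplace_expansion_row[OF A k] laplace_expansion_row[OF B k])
  finally show ?thesis by (simp add: R_def)
qed

text \<open>
  For \<open>f = (!) fs\<close> this is the relation between \<open>N\<close>, \<open>C\<close> and \<open>fs\<close> in the definition of the residue. Its
  argument is a function so that partial derivatives can be inserted directly.
\<close>

definition expresses_powers :: "'v list \<Rightarrow> (nat \<Rightarrow> 'v cpoly) \<Rightarrow> nat \<Rightarrow> 'v cpoly mat \<Rightarrow> bool" where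
  "expresses_powers ys f N C \<longleftrightarrow> C \<in> carrier_mat (length ys) (length ys) \<and>
     (\<forall>i<length ys. (\<Sum>j<length ys. C $$ (i, j) * f j) = Var (ys ! i) ^ N)"

text \<open>
  The difference of the two determinants is the determinant \<open>d\<close> of a matrix whose row \<open>k\<close> is a syzygy
  of \<open>f\<close>. This matrix maps \<open>f\<close> to the vector of powers with entry \<open>k\<close> replaced by 0, so by Cramer's rule
  every \<open>d * f j\<close> lies in the ideal of the powers of the other variables. Hence so does
  \<open>d * Var (ys ! k) ^ N\<close>, a combination of these products, and the power of \<open>ys ! k\<close> cancels.
\<close>

lemma det_diff_row_power_ideal:
  assumes ys: "distinct ys" and A: "expresses_powers ys f N A" and B: "expresses_powers ys f N B"
    and k: "k < length ys"
    and AB: "\<And>i j. i < length ys \<Longrightarrow> j < length ys \<Longrightarrow> i \<noteq> k \<Longrightarrow> A $$ (i, j) = B $$ (i, j)"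
  shows "Determinant.det A - Determinant.det B \<in> power_ideal (set ys) N"
proof -
  define n where "n = length ys"
  define S where "S = set ys - {ys ! k}"
  define R where "R = mat n n (\<lambda>(i, j). if i = k then A $$ (k, j) - B $$ (k, j) else A $$ (i, j))"
  define D where "D = Determinant.det A - Determinant.det B"
  have D: "D = Determinant.det R"
    using det_row_diff[where A = A and B = B and n = n and k = k] A B AB k
    by (simp add: n_def D_def R_def expresses_powers_def)
  have row: "(\<Sum>j<n. R $$ (i, j) * f j) = (if i = k then 0 else Var (ys ! i) ^ N)" if "i < n" for i
    using that A B k
    by (simp add: R_def n_def expresses_powers_def left_diff_distrib sum_subtractf)
  have "D * f j \<in> power_ideal S N" if "j < n" for j
  proof -
    have "ys ! i \<in> S" if "i < n" "i \<noteq> k" for i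
      using ys k that by (auto simp: S_def n_def nth_eq_iff_index_eq)
    then have "(\<Sum>i<n. adj_mat R $$ (j, i) * (if i = k then 0 else Var (ys ! i) ^ N)) \<in> power_ideal S N"
      by (auto intro!: power_ideal_sum power_ideal_mult power_ideal_Var power_ideal_0)
    then show ?thesis
      unfolding D using det_mult_solution[OF _ row that] by (simp add: R_def)
  qed
  then have "(\<Sum>j<n. A $$ (k, j) * (D * f j)) \<in> power_ideal S N"
    by (intro power_ideal_sum) (rule power_ideal_mult, simp)
  also have "(\<Sum>j<n. A $$ (k, j) * (D * f j)) = (\<Sum>j<n. A $$ (k, j) * f j) * D"
    by (simp add: sum_distrib_left mult_ac)
  also have "\<dots> = Var (ys ! k) ^ N * D"
    using A k by (simp add: expresses_powers_def n_def)
  finally have "D \<in> power_ideal S N"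
    by (rule power_ideal_cancel) (simp add: S_def)
  then show ?thesis
    using power_ideal_mono[of S "set ys" N] by (auto simp: S_def D_def)
qed

text \<open>
  Pass from \<open>B\<close> to \<open>A\<close> by exchanging one row at a time.
\<close>

lemma det_diff_power_ideal:
  assumes ys: "distinct ys" and A: "expresses_powers ys f N A" and B: "expresses_powers ys f N B"
  shows "Determinant.det A - Determinant.det B \<in> power_ideal (set ys) N"
proof -
  define n where "n = length ys"
  define H where "H k = mat n n (\<lambda>(i, j). if i < k then A $$ (i, j) else B $$ (i, j))" for k
  have carr: "A \<in> carrier_mat n n" "B \<in> carrier_mat n n"
    using A B by (simp_all add: expresses_powers_def n_def)
  have H: "expresses_powers ys f N (H k)" for k
  proof -
    have "(\<Sum>j<n. H k $$ (i, j) * f j) = Var (ys ! i) ^ N" if "i < n" for i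
      using A B that by (cases "i < k") (simp_all add: expresses_powers_def H_def n_def)
    then show ?thesis by (simp add: expresses_powers_def H_def n_def)
  qed
  have "Determinant.det (H k) - Determinant.det B \<in> power_ideal (set ys) N" if "k \<le> n" for k
    using that
  proof (induction k)
    case 0
    have "H 0 = B" using carr by (intro eq_matI) (auto simp: H_def)
    then show ?case by (simp add: power_ideal_0)
  next
    case (Suc k)
    have "Determinant.det (H (Suc k)) - Determinant.det (H k) \<in> power_ideal (set ys) N"
      using Suc.prems
      by (intro det_diff_row_power_ideal[OF ys H H, of k]) (auto simp: H_def n_def less_Suc_eq)
    from power_ideal_add[OF this Suc.IH] Suc.prems show ?case by simp
  qed
  moreover have "H n = A" using carr by (intro eq_matI) (auto simp: H_def)
  ultimately show ?thesis by (metis order_refl)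
qed

text \<open>
  Multiplying row \<open>i\<close> by \<open>Var (ys ! i) ^ m\<close> raises the exponent, which serves to bring two
  representations with different exponents to a common one.
\<close>

lemma expresses_powers_raise:
  assumes C: "expresses_powers ys f N C" and ys: "distinct ys"
  obtains C' where "expresses_powers ys f (N + m) C'"
    and "Determinant.det C' = (\<Prod>y\<in>set ys. Var y ^ m) * Determinant.det C"
proof
  define n where "n = length ys"
  define E where "E = mat n n (\<lambda>(i, j). if i = j then Var (ys ! i) ^ m else 0)"
  have carr: "C \<in> carrier_mat n n" "E \<in> carrier_mat n n"
    using C by (simp_all add: expresses_powers_def n_def E_def)
  have EC: "(E * C) $$ (i, j) = Var (ys ! i) ^ m * C $$ (i, j)" if "i < n" "j < n" for i j
  proof -
    have "(E * C) $$ (i, j) = (\<Sum>k<n. (if i = k then Var (ys ! i) ^ m else 0) * C $$ (k, j))"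
      using carr that by (simp add: scalar_prod_def E_def atLeast0LessThan)
    also have "\<dots> = (\<Sum>k<n. if k = i then Var (ys ! i) ^ m * C $$ (i, j) else 0)"
      by (rule sum.cong) auto
    finally show ?thesis using that by simp
  qed
  have "(\<Sum>j<n. (E * C) $$ (i, j) * f j) = Var (ys ! i) ^ (N + m)" if "i < n" for i
  proof -
    have "(\<Sum>j<n. (E * C) $$ (i, j) * f j) = Var (ys ! i) ^ m * (\<Sum>j<n. C $$ (i, j) * f j)"
      using that by (simp add: EC mult.assoc sum_distrib_left)
    also have "\<dots> = Var (ys ! i) ^ (N + m)"
      using C that by (simp add: expresses_powers_def n_def power_add mult.commute)
    finally show ?thesis .
  qed
  then show "expresses_powers ys f (N + m) (E * C)"
    using carr by (simp add: expresses_powers_def n_def[symmetric])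
  have "Determinant.det E = prod_list (diag_mat E)"
    by (rule det_upper_triangular[OF _ carr(2)]) (simp add: upper_triangular_def E_def)
  also have "diag_mat E = map (\<lambda>y. Var y ^ m) ys"
    by (rule nth_equalityI) (simp_all add: diag_mat_def E_def n_def)
  also have "prod_list \<dots> = (\<Prod>y\<in>set ys. Var y ^ m)"
    using ys by (rule prod.distinct_set_conv_list[symmetric])
  finally show "Determinant.det (E * C) = (\<Prod>y\<in>set ys. Var y ^ m) * Determinant.det C"
    by (simp add: det_mult[OF carr(2,1)])
qed

lemma has_residueE:
  assumes "has_residue ys fs g r"
  obtains N C where "0 < N" "expresses_powers ys ((!) fs) N C"
    "r = coeff_wrt (set ys) (N - 1) (Determinant.det C * g)"
proof -
  obtain N C where "0 < N" "C \<in> carrier_mat (length ys) (length ys)"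
      "\<forall>i<length ys. Var (ys ! i) ^ N = (\<Sum>j<length ys. C $$ (i, j) * fs ! j)"
      "r = coeff_wrt (set ys) (N - 1) (Determinant.det C * g)"
    using assms unfolding has_residue_def by blast
  then show thesis by (intro that[of N C]) (simp_all add: expresses_powers_def)
qed

text \<open>
  For a common exponent, the determinants differ by an element of the ideal of powers, which the
  coefficient extraction kills.
\<close>

lemma has_residue_unique:
  assumes ys: "distinct ys" and r: "has_residue ys fs g r" and r': "has_residue ys fs g r'"
  shows "r = r'"
proof -
  obtain N C where N: "0 < N" and C: "expresses_powers ys ((!) fs) N C"
    and rC: "r = coeff_wrt (set ys) (N - 1) (Determinant.det C * g)"
    using r by (rule has_residueE)
  obtain N' C' where N': "0 < N'" and C': "expresses_powers ys ((!) fs) N' C'"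
    and rC': "r' = coeff_wrt (set ys) (N' - 1) (Determinant.det C' * g)"
    using r' by (rule has_residueE)
  obtain E where E: "expresses_powers ys ((!) fs) (N + N') E"
    and dE: "Determinant.det E = (\<Prod>y\<in>set ys. Var y ^ N') * Determinant.det C"
    using expresses_powers_raise[OF C ys] by blast
  obtain E' where E': "expresses_powers ys ((!) fs) (N' + N) E'"
    and dE': "Determinant.det E' = (\<Prod>y\<in>set ys. Var y ^ N) * Determinant.det C'"
    using expresses_powers_raise[OF C' ys] by blast
  define K where "K = N + N' - 1"
  have K: "N + N' = Suc K" "N - Suc 0 + N' = K" "N' - Suc 0 + N = K" using N N' by (auto simp: K_def)
  have "expresses_powers ys ((!) fs) (N + N') E'"
    using E' by (simp add: add.commute)
  from power_ideal_mult[OF det_diff_power_ideal[OF ys E this], of g]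
  have "Determinant.det E * g - Determinant.det E' * g \<in> power_ideal (set ys) (Suc K)"
    by (simp add: K right_diff_distrib mult.commute)
  then have "coeff_wrt (set ys) K (Determinant.det E * g) = coeff_wrt (set ys) K (Determinant.det E' * g)"
    by (intro coeff_wrt_power_ideal) auto
  moreover have "coeff_wrt (set ys) K (Determinant.det E * g) = r"
    using coeff_wrt_shift[of "set ys" "N - 1" N' "Determinant.det C * g"]
    by (simp add: dE rC K mult.assoc)
  moreover have "coeff_wrt (set ys) K (Determinant.det E' * g) = r'"
    using coeff_wrt_shift[of "set ys" "N' - 1" N "Determinant.det C' * g"]
    by (simp add: dE' rC' K mult.assoc)
  ultimately show ?thesis by simp
qed

lemma residue_eqI:
  assumes "distinct ys" and "has_residue ys fs g r"
  shows "residue ys fs g = r"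
  unfolding residue_def using assms(2) by (rule the_equality) (rule has_residue_unique[OF assms(1) _ assms(2)])

section \<open>Finite-dimensional Jacobian algebras and non-zero residues\<close>

lemma jacobian_idealI:
  assumes "p = (\<Sum>x\<in>set xs. c x * partial x W)" "\<And>x. x \<in> set xs \<Longrightarrow> c x \<in> polys_in (set xs)"
  shows "p \<in> jacobian_ideal xs W"
  using assms by (auto simp: jacobian_ideal_def)

lemma jacobian_ideal_0: "0 \<in> jacobian_ideal xs W"
  by (rule jacobian_idealI[where c = "\<lambda>_. 0"]) auto

lemma jacobian_ideal_add:
  assumes "p \<in> jacobian_ideal xs W" "q \<in> jacobian_ideal xs W"
  shows "p + q \<in> jacobian_ideal xs W"
proof -
  obtain c where "p = (\<Sum>x\<in>set xs. c x * partial x W)" "\<forall>x\<in>set xs. c x \<in> polys_in (set xs)"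
    using assms(1) unfolding jacobian_ideal_def by blast
  moreover obtain d where "q = (\<Sum>x\<in>set xs. d x * partial x W)" "\<forall>x\<in>set xs. d x \<in> polys_in (set xs)"
    using assms(2) unfolding jacobian_ideal_def by blast
  ultimately show ?thesis
    by (intro jacobian_idealI[where c = "\<lambda>x. c x + d x"]) (auto simp: sum.distrib distrib_right)
qed

lemma jacobian_ideal_mult:
  assumes "p \<in> jacobian_ideal xs W" "q \<in> polys_in (set xs)"
  shows "q * p \<in> jacobian_ideal xs W"
proof -
  obtain c where "p = (\<Sum>x\<in>set xs. c x * partial x W)" "\<forall>x\<in>set xs. c x \<in> polys_in (set xs)"
    using assms(1) unfolding jacobian_ideal_def by blast
  then show ?thesis using assms(2)
    by (intro jacobian_idealI[where c = "\<lambda>x. q * c x"]) (auto simp: sum_distrib_left mult.assoc)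
qed

lemma module_Const: "Modules.module (\<lambda>c q. Const c * q)"
  by unfold_locales (simp_all add: Const_add Const_mult algebra_simps)

lemma finite_bounded_exponents:
  assumes "finite S"
  shows "finite {t. Poly_Mapping.keys t \<subseteq> S \<and> (\<forall>x\<in>S. Poly_Mapping.lookup t x < (N :: nat))}" (is "finite ?T")
proof (rule finite_imageD)
  have "finite {f. \<forall>x. (x \<in> S \<longrightarrow> f x \<in> {..<N}) \<and> (x \<notin> S \<longrightarrow> f x = 0)}"
    using assms by (intro finite_set_of_finite_funs) auto
  then show "finite (Poly_Mapping.lookup ` ?T)"
    by (rule rev_finite_subset) (auto simp: in_keys_iff)
  show "inj_on Poly_Mapping.lookup ?T"
    by (rule inj_onI) (rule poly_mapping_eqI, simp)
qed

text \<open>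
  Modulo the Jacobian ideal, only the finitely many monomials with all exponents below \<open>N\<close> survive.
\<close>

lemma finite_dim_jacobianI:
  assumes pow: "\<And>x. x \<in> set xs \<Longrightarrow> Var x ^ N \<in> jacobian_ideal xs W"
  shows "finite_dim_jacobian xs W"
proof -
  interpret M: Modules.module "\<lambda>c (q :: 'a cpoly). Const c * q" by (rule module_Const)
  define T where "T = {t. Poly_Mapping.keys t \<subseteq> set xs \<and> (\<forall>x\<in>set xs. Poly_Mapping.lookup t x < N)}"
  define B where "B = (\<lambda>t. Poly_Mapping.single t (1 :: complex)) ` T"
  define good where "good p \<longleftrightarrow> (\<exists>s\<in>M.span B. p - s \<in> jacobian_ideal xs W)" for p
  have good_add: "good (p + q)" if p: "good p" and q: "good q" for p q
  proof -
    obtain s s' where "s \<in> M.span B" "p - s \<in> jacobian_ideal xs W"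
        "s' \<in> M.span B" "q - s' \<in> jacobian_ideal xs W"
      using p q by (auto simp: good_def)
    moreover from this have "(p - s) + (q - s') \<in> jacobian_ideal xs W"
      by (intro jacobian_ideal_add)
    then have "(p + q) - (s + s') \<in> jacobian_ideal xs W" by (simp add: algebra_simps)
    ultimately show ?thesis unfolding good_def by (blast intro: M.span_add)
  qed
  have good_monomial: "good (Poly_Mapping.single t c)" if t: "Poly_Mapping.keys t \<subseteq> set xs" for t c
  proof (cases "t \<in> T")
    case True
    then have "Const c * Poly_Mapping.single t 1 \<in> M.span B"
      by (intro M.span_scale M.span_base) (simp add: B_def)
    then show ?thesis
      by (auto simp: good_def Const_times_monomial intro!: bexI jacobian_ideal_0)
  next
    case False
    then obtain x where x: "x \<in> set xs" "N \<le> Poly_Mapping.lookup t x"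
      using t by (auto simp: T_def not_less)
    then have "t = (t - Poly_Mapping.single x N) + Poly_Mapping.single x N"
      by (intro poly_mapping_eqI) (auto simp: lookup_add lookup_minus lookup_single when_def)
    then have "Poly_Mapping.single t c = Poly_Mapping.single (t - Poly_Mapping.single x N) c * Var x ^ N"
      by (simp add: Var_power mult_single)
    moreover have "Poly_Mapping.single (t - Poly_Mapping.single x N) c \<in> polys_in (set xs)"
      using t by (fastforce simp: polys_in_def in_keys_iff lookup_minus split: if_splits)
    ultimately have "Poly_Mapping.single t c \<in> jacobian_ideal xs W"
      using jacobian_ideal_mult[OF pow[OF x(1)]] by simp
    then show ?thesis by (auto simp: good_def intro!: bexI[of _ 0] M.span_zero)
  qed
  have "good p" if p: "p \<in> polys_in (set xs)" for p
  proof -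
    have "good (\<Sum>t\<in>U. Poly_Mapping.single t (Poly_Mapping.lookup p t))"
      if "finite U" "U \<subseteq> Poly_Mapping.keys p" for U
      using that
    proof (induction U rule: finite_induct)
      case empty
      show ?case using good_monomial[of 0 0] by simp
    next
      case (insert t U)
      then show ?case
        using p by (auto simp: polys_in_def intro!: good_add good_monomial)
    qed
    from this[OF finite_keys[of p]] show ?thesis by (simp add: sum_monomials)
  qed
  moreover have "finite B" "B \<subseteq> polys_in (set xs)"
    by (auto simp: B_def T_def finite_bounded_exponents polys_in_def)
  ultimately show ?thesis unfolding finite_dim_jacobian_def good_def by blast
qed

text \<open>
  One such matrix serves twice: it shows that the Jacobian algebra is finite-dimensional, and it
  computes residues.
\<close>

definition jacobian_powers :: "'v list \<Rightarrow> 'v cpoly \<Rightarrow> nat \<Rightarrow> 'v cpoly mat \<Rightarrow> bool" where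
  "jacobian_powers ys W N C \<longleftrightarrow> elements_mat C \<subseteq> polys_in (set ys) \<and>
     expresses_powers ys (\<lambda>j. partial (ys ! j) W) N C"

lemma jacobian_powers_finite_dim:
  assumes xs: "distinct xs" and C: "jacobian_powers xs W N C"
  shows "finite_dim_jacobian xs W"
proof (rule finite_dim_jacobianI)
  fix x assume "x \<in> set xs"
  then obtain i where i: "i < length xs" "xs ! i = x" by (auto simp: in_set_conv_nth)
  have bij: "bij_betw ((!) xs) {..<length xs} (set xs)"
    using xs by (rule bij_betw_nth) auto
  define ind where "ind = the_inv_into {..<length xs} ((!) xs)"
  have ind: "ind (xs ! j) = j" if "j < length xs" for j
    using bij that by (auto simp: ind_def bij_betw_def intro: the_inv_into_f_f)
  show "Var x ^ N \<in> jacobian_ideal xs W"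
  proof (rule jacobian_idealI[where c = "\<lambda>y. C $$ (i, ind y)"])
    have "(\<Sum>y\<in>set xs. C $$ (i, ind y) * partial y W) =
        (\<Sum>j<length xs. C $$ (i, ind (xs ! j)) * partial (xs ! j) W)"
      by (rule sum.reindex_bij_betw[OF bij, symmetric])
    also have "\<dots> = Var x ^ N"
      using C i by (simp add: ind jacobian_powers_def expresses_powers_def)
    finally show "Var x ^ N = (\<Sum>y\<in>set xs. C $$ (i, ind y) * partial y W)" by simp
    fix y assume "y \<in> set xs"
    then obtain j where "j < length xs" "y = xs ! j" by (auto simp: in_set_conv_nth)
    moreover from this i C have "C $$ (i, j) \<in> elements_mat C"
      by (intro elements_matI) (auto simp: jacobian_powers_def expresses_powers_def)
    ultimately show "C $$ (i, ind y) \<in> polys_in (set xs)"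
      using C by (auto simp: ind jacobian_powers_def)
  qed
qed

text \<open>
  A residue is a polynomial in the remaining variables; the coefficient in the assumption is its
  constant term.
\<close>

lemma residue_nonzeroI:
  assumes ys: "distinct ys" and C: "jacobian_powers ys W (Suc k) C"
    and nz: "Poly_Mapping.lookup (Determinant.det C * g) (\<Sum>y\<in>set ys. Poly_Mapping.single y k) \<noteq> 0"
  shows "residue ys (map (\<lambda>y. partial y W) ys) g \<noteq> 0"
proof -
  define r where "r = coeff_wrt (set ys) k (Determinant.det C * g)"
  have "has_residue ys (map (\<lambda>y. partial y W) ys) g r"
    unfolding has_residue_def
    using C by (intro exI[of _ "Suc k"] exI[of _ C])
      (simp add: jacobian_powers_def expresses_powers_def r_def)
  then have "residue ys (map (\<lambda>y. partial y W) ys) g = r" by (rule residue_eqI[OF ys])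
  moreover have "Poly_Mapping.lookup r 0 \<noteq> 0"
    using nz by (simp add: r_def lookup_coeff_wrt)
  ultimately show ?thesis by auto
qed

lemma signed_nonzero: "p \<noteq> 0 \<Longrightarrow> (- 1) ^ k * p \<noteq> (0 :: 'a :: comm_ring_1)"
  by (cases "even k") simp_all

section \<open>Potentials in three variables\<close>

lemma det_2: "Determinant.det (mat_of_rows_list 2 [[a, b], [c, d]]) = a * d - b * c"
proof -
  have M: "mat_of_rows_list 2 [[a, b], [c, d]] \<in> carrier_mat 2 2"
    by (rule carrier_matI) (simp_all add: mat_of_rows_list_def)
  show ?thesis
    unfolding laplace_expansion_row[OF M, of 0, simplified]
    by (simp add: cofactor_def mat_delete_def mat_of_rows_list_def det_single numeral_2_eq_2 lessThan_Suc)
qed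

lemma det_3:
  "Determinant.det (mat_of_rows_list 3 [[a, b, c], [d, e, f], [g, h, i]]) =
    a * (e * i - f * h) + b * (f * g - d * i) + c * (d * h - e * g)"
proof -
  let ?M = "mat_of_rows_list 3 [[a, b, c], [d, e, f], [g, h, i]]"
  have M: "?M \<in> carrier_mat 3 3"
    by (rule carrier_matI) (simp_all add: mat_of_rows_list_def)
  have "mat_delete ?M 0 0 = mat_of_rows_list 2 [[e, f], [h, i]]"
    "mat_delete ?M 0 1 = mat_of_rows_list 2 [[d, f], [g, i]]"
    "mat_delete ?M 0 2 = mat_of_rows_list 2 [[d, e], [g, h]]"
    by (rule eq_matI; force simp: mat_delete_def mat_of_rows_list_def numeral_eq_Suc less_Suc_eq)+
  then have cof: "cofactor ?M 0 0 = e * i - f * h" "cofactor ?M 0 (Suc 0) = f * g - d * i"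
    "cofactor ?M 0 2 = d * h - e * g"
    by (simp_all add: cofactor_def det_2)
  have sum3: "(\<Sum>j<3. u j) = u 0 + u (Suc 0) + u 2" for u :: "nat \<Rightarrow> 'a"
    by (simp add: numeral_3_eq_3 numeral_2_eq_2)
  have entries: "?M $$ (0, 0) = a" "?M $$ (0, Suc 0) = b" "?M $$ (0, 2) = c"
    by (simp_all add: mat_of_rows_list_def)
  show ?thesis
    by (simp add: laplace_expansion_row[OF M, of 0] sum3 entries cof)
qed

lemma jacobian_powers_3:
  assumes "{c00, c01, c02, c10, c11, c12, c20, c21, c22} \<subseteq> polys_in {a, b, c}"
    and "c00 * partial a W + c01 * partial b W + c02 * partial c W = Var a ^ N"
    and "c10 * partial a W + c11 * partial b W + c12 * partial c W = Var b ^ N"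
    and "c20 * partial a W + c21 * partial b W + c22 * partial c W = Var c ^ N"
  shows "jacobian_powers [a, b, c] W N
    (mat_of_rows_list 3 [[c00, c01, c02], [c10, c11, c12], [c20, c21, c22]])"
    (is "jacobian_powers _ _ _ ?C")
proof -
  have "?C \<in> carrier_mat 3 3"
    by (rule carrier_matI) (simp_all add: mat_of_rows_list_def)
  moreover have "elements_mat ?C \<subseteq> polys_in {a, b, c}"
    using assms(1) by (auto simp: elements_mat_def mat_of_rows_list_def numeral_3_eq_3 less_Suc_eq)
  ultimately show ?thesis
    using assms(2-4)
    by (auto simp: jacobian_powers_def expresses_powers_def mat_of_rows_list_def numeral_3_eq_3
        less_Suc_eq lessThan_Suc ac_simps)
qed

section \<open>Koszul matrix factorizations with three factors\<close>

text \<open>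
  The differential \<open>\<Sum>i. p\<^sub>i * (e\<^sub>i \<and> _) + q\<^sub>i * contr\<^sub>i\<close> on the exterior algebra with generators
  \<open>e\<^sub>1, e\<^sub>2, e\<^sub>3\<close>, where \<open>contr\<^sub>i\<close> is contraction with the dual of \<open>e\<^sub>i\<close>. The columns are the images of the
  even basis \<open>1, e\<^sub>1\<^sub>2, e\<^sub>1\<^sub>3, e\<^sub>2\<^sub>3\<close> followed by the odd basis \<open>e\<^sub>1, e\<^sub>2, e\<^sub>3, e\<^sub>1\<^sub>2\<^sub>3\<close>.
\<close>

definition koszul3 :: "'a \<Rightarrow> 'a \<Rightarrow> 'a \<Rightarrow> 'a \<Rightarrow> 'a \<Rightarrow> 'a \<Rightarrow> 'a :: comm_ring_1 mat" where
  "koszul3 p1 q1 p2 q2 p3 q3 = mat_of_rows_list 8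
    [[0, 0, 0, 0, q1, q2, q3, 0],
     [0, 0, 0, 0, - p2, p1, 0, q3],
     [0, 0, 0, 0, - p3, 0, p1, - q2],
     [0, 0, 0, 0, 0, - p3, p2, q1],
     [p1, - q2, - q3, 0, 0, 0, 0, 0],
     [p2, q1, 0, - q3, 0, 0, 0, 0],
     [p3, 0, q1, q2, 0, 0, 0, 0],
     [0, p3, - p2, p1, 0, 0, 0, 0]]"

text \<open>
  Row times matrix, plus \<open>c\<close>: a form of matrix multiplication on lists that the simplifier can carry
  out on explicit matrices.
\<close>

fun row_mult :: "'a list \<Rightarrow> 'a list list \<Rightarrow> 'a list \<Rightarrow> 'a :: comm_ring_1 list" where
  "row_mult (a # r) (b # B) c = row_mult r B (map2 (\<lambda>x y. a * x + y) b c)"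
| "row_mult _ _ c = c"

lemma
  assumes "length r = length B" "\<forall>b\<in>set B. length b = length c"
  shows length_row_mult: "length (row_mult r B c) = length c"
   and nth_row_mult: "j < length c \<Longrightarrow> row_mult r B c ! j = (\<Sum>(a, b)\<leftarrow>zip r B. a * b ! j) + c ! j"
  using assms by (induction r B c rule: row_mult.induct) (auto simp: algebra_simps)

lemma mat_of_rows_list_mult:
  assumes A: "\<forall>r\<in>set A. length r = length B" and B: "\<forall>b\<in>set B. length b = n"
  shows "mat_of_rows_list (length B) A * mat_of_rows_list n B =
    mat_of_rows_list n (map (\<lambda>r. row_mult r B (replicate n 0)) A)"
proof (rule eq_matI, goal_cases)
  case (1 i j)
  then have i: "i < length A" and j: "j < n" by (auto simp: mat_of_rows_list_def)
  from A i have r: "length (A ! i) = length B" by simp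
  have "row_mult (A ! i) B (replicate n 0) ! j = (\<Sum>k<length B. A ! i ! k * B ! k ! j)"
    using B j by (simp add: nth_row_mult r sum_list_sum_nth atLeast0LessThan)
  with i j show ?case
    by (simp add: mat_of_rows_list_def scalar_prod_def atLeast0LessThan)
qed (simp_all add: mat_of_rows_list_def)

lemma mat8_mult:
  assumes "length B = 8" "\<forall>r\<in>set A. length r = 8" "\<forall>b\<in>set B. length b = 8"
  shows "mat_of_rows_list 8 A * mat_of_rows_list 8 B =
    mat_of_rows_list 8 (map (\<lambda>r. row_mult r B [0,0,0,0,0,0,0,0]) A)"
  using mat_of_rows_list_mult[of A B 8] assms by (simp add: numeral_eq_Suc)

text \<open>
  The operators \<open>e\<^sub>i \<and> _\<close> and \<open>contr\<^sub>i\<close> generate a Clifford algebra, and the square of a vector of this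
  algebra is the value of its quadratic form.
\<close>

lemma koszul3_square:
  "koszul3 p1 q1 p2 q2 p3 q3 * koszul3 p1 q1 p2 q2 p3 q3 =
    (p1 * q1 + p2 * q2 + p3 * q3) \<cdot>\<^sub>m 1\<^sub>m 8"
proof -
  have one: "c \<cdot>\<^sub>m 1\<^sub>m 8 = mat_of_rows_list 8
    [[c, 0, 0, 0, 0, 0, 0, 0], [0, c, 0, 0, 0, 0, 0, 0], [0, 0, c, 0, 0, 0, 0, 0],
     [0, 0, 0, c, 0, 0, 0, 0], [0, 0, 0, 0, c, 0, 0, 0], [0, 0, 0, 0, 0, c, 0, 0],
     [0, 0, 0, 0, 0, 0, c, 0], [0, 0, 0, 0, 0, 0, 0, c]]" for c :: 'a
    by (rule eq_matI) (auto simp: mat_of_rows_list_def less_Suc_eq numeral_eq_Suc)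
  show ?thesis
    unfolding koszul3_def one by (simp add: mat8_mult algebra_simps)
qed

text \<open>
  Orthogonal vectors of a Clifford algebra anticommute.
\<close>

lemma koszul3_anticommute:
  "koszul3 0 0 0 0 p3 q3 * koszul3 p1 q1 p2 q2 0 0 =
   koszul3 (- p1) (- q1) (- p2) (- q2) 0 0 * koszul3 0 0 0 0 p3 q3"
  unfolding koszul3_def by (simp add: mat8_mult algebra_simps)

lemma koszul3_carrier: "koszul3 p1 q1 p2 q2 p3 q3 \<in> carrier_mat 8 8"
  by (rule carrier_matI) (simp_all add: koszul3_def mat_of_rows_list_def)

lemma supertrace_rows:
  "supertrace 4 4 (mat_of_rows_list 8 [r0, r1, r2, r3, r4, r5, r6, r7]) =
   r0 ! 0 + r1 ! 1 + r2 ! 2 + r3 ! 3 - (r4 ! 4 + r5 ! 5 + r6 ! 6 + r7 ! 7)"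
  by (simp add: supertrace_def mat_of_rows_list_def numeral_eq_Suc lessThan_Suc atLeastLessThanSuc algebra_simps)

text \<open>
  The supertrace of a product of six vectors of this Clifford algebra is alternating, because exchanging
  two neighbours costs a multiple of a product of four vectors, which has supertrace 0. It is therefore,
  up to sign, the determinant of the six coordinate vectors. If the vectors are the partial derivatives of a Koszul
  differential, this is the Jacobian determinant of \<open>p\<^sub>1, q\<^sub>1, p\<^sub>2, q\<^sub>2, p\<^sub>3, q\<^sub>3\<close>. The six vectors have the
  zero pattern of the derivatives of \<open>Q10_K14_mf\<close>, where the determinant splits into a block for the
  pair \<open>p\<^sub>3, q\<^sub>3\<close> and one for the other two pairs.
\<close>

lemma supertrace_koszul3:
  "supertrace 4 4 (koszul3 1 a 0 0 0 0 * (koszul3 0 0 0 0 1 b * (koszul3 0 c d d 0 0 *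
     (koszul3 e f g h 0 0 * (koszul3 0 0 0 0 (-1) k * (koszul3 0 0 (-1) 1 0 0 * 1\<^sub>m 8)))))) =
   (b + k) * (2 * d * f - c * (g + h) - 2 * a * d * e)"
  unfolding right_mult_one_mat[OF koszul3_carrier]
  unfolding koszul3_def
  by (simp add: mat8_mult supertrace_rows) (simp add: algebra_simps)

lemma koszul3_map:
  assumes "f 0 = 0" "\<And>a. f (- a) = - f a"
  shows "map_mat f (koszul3 p1 q1 p2 q2 p3 q3) = koszul3 (f p1) (f q1) (f p2) (f q2) (f p3) (f q3)"
proof (rule eq_matI, goal_cases)
  case (1 i j)
  then have "i \<in> {0, 1, 2, 3, 4, 5, 6, 7}" "j \<in> {0, 1, 2, 3, 4, 5, 6, 7}"
    by (auto simp: koszul3_def mat_of_rows_list_def)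
  then show ?case
    by (auto simp: koszul3_def mat_of_rows_list_def assms)
qed (simp_all add: koszul3_def mat_of_rows_list_def)

lemma elements_koszul3:
  "elements_mat (koszul3 p1 q1 p2 q2 p3 q3) \<subseteq>
    {0, p1, q1, p2, q2, p3, q3, - p2, - q2, - p3, - q3}"
proof
  fix e assume "e \<in> elements_mat (koszul3 p1 q1 p2 q2 p3 q3)"
  then obtain i j where ij: "i < 8" "j < 8" "e = koszul3 p1 q1 p2 q2 p3 q3 $$ (i, j)"
    using elements_matD by (metis carrier_matD koszul3_carrier)
  then have "i \<in> {0, 1, 2, 3, 4, 5, 6, 7}" "j \<in> {0, 1, 2, 3, 4, 5, 6, 7}"
    by auto
  with ij(3) show "e \<in> {0, p1, q1, p2, q2, p3, q3, - p2, - q2, - p3, - q3}"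
    by (auto simp: koszul3_def mat_of_rows_list_def)
qed

lemma matrix_factorization_koszul3:
  assumes "{p1, q1, p2, q2, p3, q3} \<subseteq> polys_in S" and "F = p1 * q1 + p2 * q2 + p3 * q3"
  shows "matrix_factorization S F 4 4 (koszul3 p1 q1 p2 q2 p3 q3)"
  unfolding matrix_factorization_def
proof (intro conjI)
  show "elements_mat (koszul3 p1 q1 p2 q2 p3 q3) \<subseteq> polys_in S"
    using assms(1) by (intro order_trans[OF elements_koszul3]) auto
  show "odd_mat 4 4 (koszul3 p1 q1 p2 q2 p3 q3)"
    unfolding odd_mat_def
  proof (intro allI impI)
    fix i j :: nat assume ij: "i < 4 + 4" "j < 4 + 4" "(i < 4) = (j < 4)"
    then have "i \<in> {0, 1, 2, 3, 4, 5, 6, 7}" "j \<in> {0, 1, 2, 3, 4, 5, 6, 7}"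
      by auto
    with ij(3) show "koszul3 p1 q1 p2 q2 p3 q3 $$ (i, j) = 0"
      by (auto simp: koszul3_def mat_of_rows_list_def)
  qed
qed (simp_all add: koszul3_carrier koszul3_square assms(2))

section \<open>The matrix factorization\<close>

text \<open>
  The variables \<open>a\<close> and \<open>c\<close> are those of degree \<open>1/4\<close> and \<open>2/3\<close> in the second potential. Restricting
  \<open>x ^ 4 + x * z ^ 2 - (w + t * a ^ 4) ^ 2 - s ^ 8 * a ^ 8\<close> to \<open>x = s ^ 2 * a ^ 2\<close> leaves the difference of
  squares \<open>(s * a * z) ^ 2 - (w + t * a ^ 4) ^ 2\<close>, whose two factors form the second pair. The first
  pair is \<open>x - s ^ 2 * a ^ 2\<close> and the quotient of the remaining terms by it; the third pair factors \<open>y ^ 3 - c ^ 3\<close>.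
\<close>

definition Q10_K14_mf :: "indet \<Rightarrow> indet \<Rightarrow> complex \<Rightarrow> complex \<Rightarrow> indet cpoly mat" where
  "Q10_K14_mf a c s t = koszul3
     (Var Ix - Const s ^ 2 * Var a ^ 2)
     (Var Ix ^ 3 + Const s ^ 2 * Var Ix ^ 2 * Var a ^ 2 + Const s ^ 4 * Var Ix * Var a ^ 4
        + Const s ^ 6 * Var a ^ 6 + Var Iz ^ 2)
     (Const s * Var a * Var Iz - Var Iw - Const t * Var a ^ 4)
     (Const s * Var a * Var Iz + Var Iw + Const t * Var a ^ 4)
     (Var Iy - Var c)
     (Var Iy ^ 2 + Var Iy * Var c + Var c ^ 2)"

lemma matrix_factorization_mf:
  "matrix_factorization {Ix, Iy, Iz, a, c, Iw}
     (Q10 - (Var c ^ 3 + Var Iw ^ 2 + Const (2 * t) * Var a ^ 4 * Var Iw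
        + Const (t ^ 2 + s ^ 8) * Var a ^ 8)) 4 4 (Q10_K14_mf a c s t)"
  unfolding Q10_K14_mf_def
  by (rule matrix_factorization_koszul3)
    (auto simp: Q10_def Const_add Const_mult Const_power algebra_simps power2_eq_square power_numeral_reduce
      intro!: polys_in_add polys_in_diff polys_in_mult polys_in_power)

lemmas partial_simps = partial_add partial_diff partial_mult partial_power partial_Var

text \<open>
  Up to sign, the Jacobian determinant of the six entries of \<open>Q10_K14_mf\<close> with respect to all
  variables. It is independent of \<open>t\<close>, since \<open>w \<mapsto> w + t * a ^ 4\<close> is a unimodular substitution.
\<close>

definition Q10_K14_jacobian :: "indet \<Rightarrow> indet \<Rightarrow> complex \<Rightarrow> indet cpoly" where
  "Q10_K14_jacobian a c s = 12 * (Var Iy + Var c) * Const s *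
     (4 * Const s ^ 2 * Var Ix ^ 2 * Var a ^ 2 + 4 * Const s ^ 4 * Var Ix * Var a ^ 4
       + 4 * Const s ^ 6 * Var a ^ 6 - Var Iz ^ 2)"

lemma partial_mf:
  assumes "{a, c} = {Iu, Iv}"
  shows
    "map_mat (partial Ix) (Q10_K14_mf a c s t) = koszul3 1
       (3 * Var Ix ^ 2 + 2 * Const s ^ 2 * Var Ix * Var a ^ 2 + Const s ^ 4 * Var a ^ 4) 0 0 0 0"
    "map_mat (partial Iy) (Q10_K14_mf a c s t) = koszul3 0 0 0 0 1 (2 * Var Iy + Var c)"
    "map_mat (partial Iz) (Q10_K14_mf a c s t) =
       koszul3 0 (2 * Var Iz) (Const s * Var a) (Const s * Var a) 0 0"
    "map_mat (partial a) (Q10_K14_mf a c s t) = koszul3 (- 2 * Const s ^ 2 * Var a)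
       (2 * Const s ^ 2 * Var Ix ^ 2 * Var a + 4 * Const s ^ 4 * Var Ix * Var a ^ 3
         + 6 * Const s ^ 6 * Var a ^ 5)
       (Const s * Var Iz - 4 * Const t * Var a ^ 3) (Const s * Var Iz + 4 * Const t * Var a ^ 3) 0 0"
    "map_mat (partial c) (Q10_K14_mf a c s t) = koszul3 0 0 0 0 (- 1) (Var Iy + 2 * Var c)"
    "map_mat (partial Iw) (Q10_K14_mf a c s t) = koszul3 0 0 (- 1) 1 0 0"
  using assms
  unfolding Q10_K14_mf_def koszul3_map[where f = "partial _", OF partial_0 partial_uminus]
    doubleton_eq_iff
  by (elim disjE conjE; simp add: partial_simps algebra_simps)+

lemma supertrace_mf:
  shows "supertrace 4 4 (partials_prod ([Ix, Iy, Iz] @ [Iu, Iv, Iw]) (Q10_K14_mf Iu Iv s t)) =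
      Q10_K14_jacobian Iu Iv s"
    and "supertrace 4 4 (partials_prod ([Ix, Iy, Iz] @ [Iu, Iv, Iw]) (Q10_K14_mf Iv Iu s t)) =
      - Q10_K14_jacobian Iv Iu s"
proof -
  have dim: "dim_row (Q10_K14_mf a c s t) = 8" for a c
    using koszul3_carrier unfolding Q10_K14_mf_def by blast
  show "supertrace 4 4 (partials_prod ([Ix, Iy, Iz] @ [Iu, Iv, Iw]) (Q10_K14_mf Iu Iv s t)) =
      Q10_K14_jacobian Iu Iv s"
    unfolding partials_prod_def append.simps list.map foldr.simps o_apply id_apply dim
    by (simp add: partial_mf supertrace_koszul3 Q10_K14_jacobian_def)
      (simp add: algebra_simps power2_eq_square power_numeral_reduce)
  \<comment> \<open>When \<open>c\<close> comes before \<open>a\<close> in the list of variables, two factors are not in the order of \<open>supertrace_koszul3\<close>.\<close>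
  have swap: "koszul3 0 0 0 0 (- 1) k * (koszul3 e f g h 0 0 * X) =
      koszul3 (- e) (- f) (- g) (- h) 0 0 * (koszul3 0 0 0 0 (- 1) k * X)"
    if "X \<in> carrier_mat 8 8" for e f g h k :: "indet cpoly" and X
    unfolding assoc_mult_mat[OF koszul3_carrier koszul3_carrier that, symmetric]
    by (simp only: koszul3_anticommute)
  show "supertrace 4 4 (partials_prod ([Ix, Iy, Iz] @ [Iu, Iv, Iw]) (Q10_K14_mf Iv Iu s t)) =
      - Q10_K14_jacobian Iv Iu s"
    unfolding partials_prod_def append.simps list.map foldr.simps o_apply id_apply dim
    by (simp only: partial_mf[OF insert_commute], subst swap,
        rule mult_carrier_mat[OF koszul3_carrier one_carrier_mat],
        simp only: supertrace_koszul3 Q10_K14_jacobian_def)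
      (simp add: algebra_simps power2_eq_square power_numeral_reduce)
qed

section \<open>Coefficients of explicit polynomials\<close>

definition expo :: "nat \<Rightarrow> nat \<Rightarrow> nat \<Rightarrow> nat \<Rightarrow> nat \<Rightarrow> nat \<Rightarrow> indet \<Rightarrow>\<^sub>0 nat" where
  "expo i j k l m n = Poly_Mapping.single Ix i + Poly_Mapping.single Iy j + Poly_Mapping.single Iz k
     + Poly_Mapping.single Iu l + Poly_Mapping.single Iv m + Poly_Mapping.single Iw n"

lemma lookup_expo:
  "Poly_Mapping.lookup (expo i j k l m n) Ix = i" "Poly_Mapping.lookup (expo i j k l m n) Iy = j"
  "Poly_Mapping.lookup (expo i j k l m n) Iz = k" "Poly_Mapping.lookup (expo i j k l m n) Iu = l"
  "Poly_Mapping.lookup (expo i j k l m n) Iv = m" "Poly_Mapping.lookup (expo i j k l m n) Iw = n"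
  by (simp_all add: expo_def lookup_add lookup_single)

lemma expo_eq_iff:
  "expo i j k l m n = expo i' j' k' l' m' n' \<longleftrightarrow>
    i = i' \<and> j = j' \<and> k = k' \<and> l = l' \<and> m = m' \<and> n = n'"
  by (metis lookup_expo)

lemma expo_add: "expo i j k l m n + expo i' j' k' l' m' n' =
    expo (i + i') (j + j') (k + k') (l + l') (m + m') (n + n')"
  by (simp add: expo_def single_add ac_simps)

lemma single_expo:
  "Poly_Mapping.single Ix e = expo e 0 0 0 0 0" "Poly_Mapping.single Iy e = expo 0 e 0 0 0 0"
  "Poly_Mapping.single Iz e = expo 0 0 e 0 0 0" "Poly_Mapping.single Iu e = expo 0 0 0 e 0 0"
  "Poly_Mapping.single Iv e = expo 0 0 0 0 e 0" "Poly_Mapping.single Iw e = expo 0 0 0 0 0 e"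
  by (simp_all add: expo_def)

lemma Const_expo: "Const c = Poly_Mapping.single (expo 0 0 0 0 0 0) c"
  and numeral_expo: "numeral n = Poly_Mapping.single (expo 0 0 0 0 0 0) (numeral n :: complex)"
  by (simp_all add: expo_def Const_def)

lemma expo_power:
  "Poly_Mapping.single (expo i j k l m n) (d :: complex) ^ e =
    Poly_Mapping.single (expo (e * i) (e * j) (e * k) (e * l) (e * m) (e * n)) (d ^ e)"
proof (induction e)
  case 0
  show ?case using numeral_expo[of num.One] by simp
qed (simp add: mult_single expo_add)

text \<open>
  Rewriting with the first collection and then with the second one turns an explicit polynomial into a
  sum of monomials and reads off its coefficients.
\<close>

lemmas to_monomials = expo_power Var_def single_expo Const_expo numeral_expo

lemmas coefficient_simps = distrib_left distrib_right left_diff_distrib right_diff_distrib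
  mult_single expo_add lookup_add lookup_minus lookup_single expo_eq_iff

section \<open>The potentials\<close>

text \<open>
  All degrees are multiples of \<open>1/12\<close>, so a single root of \<open>l\<close> turns the homogeneity of the potentials
  into polynomial identities.
\<close>

lemma weights:
  assumes "l \<noteq> 0"
  obtains e :: complex where "l ^ 2 = e ^ 24" "l powr 1 = e ^ 12" "l powr (1 / 2) = e ^ 6"
    "l powr (2 / 3) = e ^ 8" "l powr (3 / 4) = e ^ 9" "l powr (1 / 4) = e ^ 3"
proof
  have e: "exp (ln l / 12) ^ n = l powr (of_nat n / 12)" for n
    using assms by (simp add: powr_def exp_of_nat_mult[symmetric])
  show "l powr 1 = exp (ln l / 12) ^ 12" "l powr (1 / 2) = exp (ln l / 12) ^ 6"
    "l powr (2 / 3) = exp (ln l / 12) ^ 8" "l powr (3 / 4) = exp (ln l / 12) ^ 9"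
    "l powr (1 / 4) = exp (ln l / 12) ^ 3"
    unfolding e by simp_all
  show "l ^ 2 = exp (ln l / 12) ^ 24"
    using e[of 12] assms power_mult[of "exp (ln l / 12)" 12 2] by simp
qed

lemma homogeneous_Q10:
  assumes "l \<noteq> 0"
  shows "eval_poly (\<lambda>x. l powr of_rat (((\<lambda>_. 0)(Ix := 1/2, Iy := 2/3, Iz := 3/4)) x) * b x) Q10 =
     l ^ 2 * eval_poly b Q10"
proof -
  from assms obtain e where e: "l ^ 2 = e ^ 24" "l powr 1 = e ^ 12" "l powr (1 / 2) = e ^ 6"
    "l powr (2 / 3) = e ^ 8" "l powr (3 / 4) = e ^ 9" "l powr (1 / 4) = e ^ 3"
    by (rule weights)
  show ?thesis unfolding Q10_def eval_poly_add eval_poly_mult eval_poly_power eval_poly_Var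
    by (simp add: of_rat_divide e power_mult_distrib distrib_left mult_ac del: powr_to_1 flip: power_mult power_add)
qed

lemma homogeneous_K14_1:
  assumes "l \<noteq> 0"
  shows "eval_poly (\<lambda>x. l powr of_rat (((\<lambda>_. 0)(Iu := 1/4, Iv := 2/3, Iw := 1)) x) * b x) K14_1 =
     l ^ 2 * eval_poly b K14_1"
proof -
  from assms obtain e where e: "l ^ 2 = e ^ 24" "l powr 1 = e ^ 12" "l powr (1 / 2) = e ^ 6"
    "l powr (2 / 3) = e ^ 8" "l powr (3 / 4) = e ^ 9" "l powr (1 / 4) = e ^ 3"
    by (rule weights)
  show ?thesis unfolding K14_1_def eval_poly_add eval_poly_mult eval_poly_power eval_poly_Var
    by (simp add: of_rat_divide e power_mult_distrib distrib_left mult_ac del: powr_to_1 flip: power_mult power_add)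
qed

lemma homogeneous_K14_2:
  assumes "l \<noteq> 0"
  shows "eval_poly (\<lambda>x. l powr of_rat (((\<lambda>_. 0)(Iu := 2/3, Iv := 1/4, Iw := 1)) x) * b x) K14_2 =
     l ^ 2 * eval_poly b K14_2"
proof -
  from assms obtain e where e: "l ^ 2 = e ^ 24" "l powr 1 = e ^ 12" "l powr (1 / 2) = e ^ 6"
    "l powr (2 / 3) = e ^ 8" "l powr (3 / 4) = e ^ 9" "l powr (1 / 4) = e ^ 3"
    by (rule weights)
  show ?thesis unfolding K14_2_def eval_poly_add eval_poly_mult eval_poly_power eval_poly_Var
    by (simp add: of_rat_divide e power_mult_distrib distrib_left mult_ac del: powr_to_1 flip: power_mult power_add)
qed

text \<open>
  The rows solve \<open>y\<^sub>i ^ N = (\<Sum>j. C\<^sub>i\<^sub>j * \<partial>\<^sub>jW)\<close> with \<open>N = 4\<close> for \<open>Q10\<close> and \<open>N = 7\<close> for the two others. For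
  instance \<open>z ^ 3 = z * \<partial>\<^sub>xQ10 - 2 * x ^ 2 * \<partial>\<^sub>zQ10\<close>, and for \<open>K14_1\<close>
  \<open>u ^ 7 = u ^ 3 * \<partial>\<^sub>w - \<partial>\<^sub>u / 2\<close> and \<open>w ^ 2 = w * \<partial>\<^sub>w / 2 - u * \<partial>\<^sub>u / 8\<close>.
\<close>

abbreviation powers_Q10 :: "indet cpoly mat" where
  "powers_Q10 \<equiv> mat_of_rows_list 3
    [[Const (1 / 4) * Var Ix, 0, Const (- 1 / 8) * Var Iz],
     [0, Const (1 / 3) * Var Iy ^ 2, 0],
     [Var Iz ^ 2, 0, - 2 * Var Ix ^ 2 * Var Iz]]"

abbreviation powers_K14_1 :: "indet cpoly mat" where
  "powers_K14_1 \<equiv> mat_of_rows_list 3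
    [[Const (- 1 / 2), 0, Var Iu ^ 3],
     [0, Const (1 / 3) * Var Iv ^ 5, 0],
     [Const (- 1 / 8) * Var Iu * Var Iw ^ 5, 0, Const (1 / 2) * Var Iw ^ 6]]"

abbreviation powers_K14_2 :: "indet cpoly mat" where
  "powers_K14_2 \<equiv> mat_of_rows_list 3
    [[Const (1 / 3) * Var Iu ^ 5, 0, 0],
     [0, Const (1 / 8), 0],
     [0, 0, Const (1 / 2) * Var Iw ^ 6]]"

lemma partial_Q10:
  "partial Ix Q10 = 4 * Var Ix ^ 3 + Var Iz ^ 2"
  "partial Iy Q10 = 3 * Var Iy ^ 2"
  "partial Iz Q10 = 2 * Var Ix * Var Iz"
  by (simp_all add: Q10_def partial_simps)

lemma partial_K14_1:
  "partial Iu K14_1 = 4 * Var Iu ^ 3 * Var Iw"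
  "partial Iv K14_1 = 3 * Var Iv ^ 2"
  "partial Iw K14_1 = Var Iu ^ 4 + 2 * Var Iw"
  by (simp_all add: K14_1_def partial_simps)

lemma partial_K14_2:
  "partial Iu K14_2 = 3 * Var Iu ^ 2"
  "partial Iv K14_2 = 8 * Var Iv ^ 7"
  "partial Iw K14_2 = 2 * Var Iw"
  by (simp_all add: K14_2_def partial_simps)

lemma jacobian_powers_Q10: "jacobian_powers [Ix, Iy, Iz] Q10 4 powers_Q10"
  by (rule jacobian_powers_3; simp add: partial_Q10; (auto intro!: polys_in_mult polys_in_uminus)?;
      simp add: to_monomials coefficient_simps single_add[symmetric] eval_nat_numeral flip: single_uminus)

lemma jacobian_powers_K14_1: "jacobian_powers [Iu, Iv, Iw] K14_1 7 powers_K14_1"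
  by (rule jacobian_powers_3; simp add: partial_K14_1; (auto intro!: polys_in_mult polys_in_uminus)?;
      simp add: to_monomials coefficient_simps single_add[symmetric] eval_nat_numeral flip: single_uminus)

lemma jacobian_powers_K14_2: "jacobian_powers [Iu, Iv, Iw] K14_2 7 powers_K14_2"
  by (rule jacobian_powers_3; simp add: partial_K14_2; (auto intro!: polys_in_mult polys_in_uminus)?;
      simp add: to_monomials coefficient_simps single_add[symmetric] eval_nat_numeral flip: single_uminus)

lemma potential_Q10: "potential [Ix, Iy, Iz] ((\<lambda>_. 0)(Ix := 1/2, Iy := 2/3, Iz := 3/4)) Q10"
proof -
  have "Q10 \<in> polys_in {Ix, Iy, Iz}"
    unfolding Q10_def by (intro polys_in_add polys_in_mult polys_in_power polys_in_Var) auto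
  then show ?thesis
    using jacobian_powers_finite_dim[OF _ jacobian_powers_Q10]
    by (simp add: potential_def homogeneous_Q10 del: fun_upd_apply) simp
qed

lemma potential_K14_1: "potential [Iu, Iv, Iw] ((\<lambda>_. 0)(Iu := 1/4, Iv := 2/3, Iw := 1)) K14_1"
proof -
  have "K14_1 \<in> polys_in {Iu, Iv, Iw}"
    unfolding K14_1_def by (intro polys_in_add polys_in_mult polys_in_power polys_in_Var) auto
  then show ?thesis
    using jacobian_powers_finite_dim[OF _ jacobian_powers_K14_1]
    by (simp add: potential_def homogeneous_K14_1 del: fun_upd_apply) simp
qed

lemma potential_K14_2: "potential [Iu, Iv, Iw] ((\<lambda>_. 0)(Iu := 2/3, Iv := 1/4, Iw := 1)) K14_2"
proof -
  have "K14_2 \<in> polys_in {Iu, Iv, Iw}"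
    unfolding K14_2_def by (intro polys_in_add polys_in_mult polys_in_power polys_in_Var) auto
  then show ?thesis
    using jacobian_powers_finite_dim[OF _ jacobian_powers_K14_2]
    by (simp add: potential_def homogeneous_K14_2 del: fun_upd_apply) simp
qed

lemma det_jac_Q10: "Determinant.det powers_Q10 =
  Const (1 / 3) * Var Iy ^ 2 * (Const (- 1 / 2) * Var Ix ^ 3 * Var Iz + Const (1 / 8) * Var Iz ^ 3)"
  unfolding det_3
  by (simp add: to_monomials coefficient_simps eval_nat_numeral flip: single_uminus)

lemma det_jac_K14_1: "Determinant.det powers_K14_1 =
  Const (1 / 3) * Var Iv ^ 5 * Var Iw ^ 5 * (Const (1 / 8) * Var Iu ^ 4 - Const (1 / 4) * Var Iw)"
  unfolding det_3
  by (simp add: to_monomials coefficient_simps eval_nat_numeral flip: single_uminus single_add single_diff)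

lemma det_jac_K14_2: "Determinant.det powers_K14_2 = Const (1 / 48) * Var Iu ^ 5 * Var Iw ^ 6"
  unfolding det_3
  by (simp add: to_monomials coefficient_simps eval_nat_numeral)

section \<open>Quantum dimensions\<close>

text \<open>
  The product of \<open>y ^ 2 / 3\<close> and \<open>- x ^ 3 * z / 2\<close> in the determinant meets \<open>- 12 * s * y * z ^ 2\<close> in the
  supertrace.
\<close>

lemma coefficient_right:
  assumes "{a, c} = {Iu, Iv}"
  shows "Poly_Mapping.lookup (Determinant.det powers_Q10 * Q10_K14_jacobian a c s)
    (\<Sum>y\<in>set [Ix, Iy, Iz]. Poly_Mapping.single y 3) = 2 * s"
proof -
  have "a = Iu \<and> c = Iv \<or> a = Iv \<and> c = Iu"
    using assms by (auto simp: doubleton_eq_iff)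
  then show ?thesis
    unfolding det_jac_Q10 Q10_K14_jacobian_def
    by (elim disjE conjE) (simp_all add: to_monomials coefficient_simps)
qed

text \<open>
  Here and in the next lemma, the term \<open>48 * s ^ 7 * c * a ^ 6\<close> of the supertrace contributes.
\<close>

lemma coefficient_left_1:
  "Poly_Mapping.lookup (Determinant.det powers_K14_1 * Q10_K14_jacobian Iu Iv s)
    (\<Sum>y\<in>set [Iu, Iv, Iw]. Poly_Mapping.single y 6) = - 4 * s ^ 7"
  unfolding det_jac_K14_1 Q10_K14_jacobian_def
  by (simp add: to_monomials) (simp add: coefficient_simps power_numeral_reduce)

lemma coefficient_left_2:
  "Poly_Mapping.lookup (Determinant.det powers_K14_2 * Q10_K14_jacobian Iv Iu s)
    (\<Sum>y\<in>set [Iu, Iv, Iw]. Poly_Mapping.single y 6) = s ^ 7"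
  unfolding det_jac_K14_2 Q10_K14_jacobian_def
  by (simp add: to_monomials) (simp add: coefficient_simps power_numeral_reduce)

lemma orbifold_equivalentI:
  assumes V: "potential xs degx V" and W: "potential ys degy W" and disj: "set xs \<inter> set ys = {}"
    and mf: "matrix_factorization (set xs \<union> set ys) (V - W) r0 r1 D"
    and str: "supertrace r0 r1 (partials_prod (xs @ ys) D) = g"
    and A: "jacobian_powers xs V (Suc k) A"
      "Poly_Mapping.lookup (Determinant.det A * g) (\<Sum>x\<in>set xs. Poly_Mapping.single x k) \<noteq> 0"
    and B: "jacobian_powers ys W (Suc l) B"
      "Poly_Mapping.lookup (Determinant.det B * g) (\<Sum>y\<in>set ys. Poly_Mapping.single y l) \<noteq> 0"
  shows "orbifold_equivalent xs degx V ys degy W"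
proof -
  have "distinct xs" "distinct ys" using V W by (simp_all add: potential_def)
  from residue_nonzeroI[OF this(1) A] residue_nonzeroI[OF this(2) B]
  have "qdim_l xs ys W r0 r1 D \<noteq> 0" "qdim_r xs ys V r0 r1 D \<noteq> 0"
    unfolding qdim_l_def qdim_r_def str by (simp_all only: signed_nonzero not_False_eq_True)
  then show ?thesis
    using V W disj mf unfolding orbifold_equivalent_def by blast
qed

lemma ex_eighth_root: "\<exists>s :: complex. s ^ 8 = - 1 / 4"
proof -
  have "csqrt (csqrt (csqrt (- 1 / 4))) ^ (2 * (2 * 2)) = - 1 / 4"
    unfolding power_mult power2_csqrt ..
  then show ?thesis by (intro exI) simp
qed

theorem mainTheorem1:
  shows
    "orbifold_equivalent
       [Ix, Iy, Iz] ((\<lambda>_. 0)(Ix := 1/2, Iy := 2/3, Iz := 3/4)) Q10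
       [Iu, Iv, Iw] ((\<lambda>_. 0)(Iu := 1/4, Iv := 2/3, Iw := 1)) K14_1
   \<and> orbifold_equivalent
       [Ix, Iy, Iz] ((\<lambda>_. 0)(Ix := 1/2, Iy := 2/3, Iz := 3/4)) Q10
       [Iu, Iv, Iw] ((\<lambda>_. 0)(Iu := 2/3, Iv := 1/4, Iw := 1)) K14_2"
proof
  \<comment> \<open>\<open>K14_1 = v ^ 3 + (w + u ^ 4 / 2) ^ 2 - u ^ 8 / 4\<close>, hence \<open>t = 1 / 2\<close> and \<open>s ^ 8 = - 1 / 4\<close>.\<close>
  obtain s :: complex where s: "s ^ 8 = - 1 / 4" using ex_eighth_root by blast
  then have nz: "s \<noteq> 0" by auto
  have K: "K14_1 = Var Iv ^ 3 + Var Iw ^ 2 + Const (2 * (1 / 2)) * Var Iu ^ 4 * Var Iw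
        + Const ((1 / 2) ^ 2 + s ^ 8) * Var Iu ^ 8"
    by (simp add: K14_1_def s power2_eq_square)
  have mf: "matrix_factorization (set [Ix, Iy, Iz] \<union> set [Iu, Iv, Iw]) (Q10 - K14_1) 4 4
      (Q10_K14_mf Iu Iv s (1 / 2))"
    unfolding K using matrix_factorization_mf[of Iu Iv "1 / 2" s] by (simp add: insert_commute)
  show "orbifold_equivalent
       [Ix, Iy, Iz] ((\<lambda>_. 0)(Ix := 1/2, Iy := 2/3, Iz := 3/4)) Q10
       [Iu, Iv, Iw] ((\<lambda>_. 0)(Iu := 1/4, Iv := 2/3, Iw := 1)) K14_1"
  proof (rule orbifold_equivalentI[OF potential_Q10 potential_K14_1 _ mf supertrace_mf(1)])
    show "jacobian_powers [Ix, Iy, Iz] Q10 (Suc 3) powers_Q10"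
      using jacobian_powers_Q10 by simp
    show "jacobian_powers [Iu, Iv, Iw] K14_1 (Suc 6) powers_K14_1"
      using jacobian_powers_K14_1 by simp
  qed (use nz in \<open>simp_all only: coefficient_right coefficient_left_1, simp_all\<close>)
next
  have K: "K14_2 = Var Iu ^ 3 + Var Iw ^ 2 + Const (2 * 0) * Var Iv ^ 4 * Var Iw
        + Const (0 ^ 2 + 1 ^ 8) * Var Iv ^ 8"
    by (simp add: K14_2_def)
  have mf: "matrix_factorization (set [Ix, Iy, Iz] \<union> set [Iu, Iv, Iw]) (Q10 - K14_2) 4 4
      (Q10_K14_mf Iv Iu 1 0)"
    unfolding K using matrix_factorization_mf[of Iv Iu 0 1] by (simp add: insert_commute)
  show "orbifold_equivalent
       [Ix, Iy, Iz] ((\<lambda>_. 0)(Ix := 1/2, Iy := 2/3, Iz := 3/4)) Q10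
       [Iu, Iv, Iw] ((\<lambda>_. 0)(Iu := 2/3, Iv := 1/4, Iw := 1)) K14_2"
  proof (rule orbifold_equivalentI[OF potential_Q10 potential_K14_2 _ mf supertrace_mf(2)])
    show "jacobian_powers [Ix, Iy, Iz] Q10 (Suc 3) powers_Q10"
      using jacobian_powers_Q10 by simp
    show "jacobian_powers [Iu, Iv, Iw] K14_2 (Suc 6) powers_K14_2"
      using jacobian_powers_K14_2 by simp
    show "Poly_Mapping.lookup (Determinant.det powers_Q10 * - Q10_K14_jacobian Iv Iu 1)
        (\<Sum>x\<in>set [Ix, Iy, Iz]. Poly_Mapping.single x 3) \<noteq> 0"
      unfolding mult_minus_right lookup_uminus coefficient_right[OF insert_commute] by simp
    show "Poly_Mapping.lookup (Determinant.det powers_K14_2 * - Q10_K14_jacobian Iv Iu 1)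
        (\<Sum>y\<in>set [Iu, Iv, Iw]. Poly_Mapping.single y 6) \<noteq> 0"
      unfolding mult_minus_right lookup_uminus coefficient_left_2 by simp
  qed simp
qed

end
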